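(* Let $r\geq 2$, $t\geq 3$ with $t\mid n$, and $\alpha\in(0,1]$ with $\alpha n/t$ an integer and $\alpha\leq\min(1/2,(r-1)^{-1/2})$. Any one-way quantum protocol (one quantum message from Alice to Bob) that achieves advantage $\varepsilon>0$ for the $r$-ary Hidden Hypermatching problem $r\text{-}\mathsf{HH}(\alpha,t,n)$ requires at least $m=\Omega\big(r^{-(1+1/t)}(\varepsilon^2/\alpha)^{2/t}(n/t)^{1-2/t}\big)$ qubits of communication from Alice to Bob.
   Context: An $\alpha$-partial $t$-hypermatching on $[n]$ is a sequence of $\alpha n/t$ pairwise disjoint hyperedges, each consisting of $t$ distinct elements of $[n]$; its incidence matrix $M\in\{0,1\}^{\alpha n/t\times n}$ has row $i$ equal to the indicator of the $i$-th hyperedge. In $r\text{-}\mathsf{HH}(\alpha,t,n)$, Alice gets $x\in\mathbb{Z}_r^n$, Bob gets an $\alpha$-partial $t$-hypermatching $M$ and a string $w\in\mathbb{Z}_r^{\alpha n/t}$; under the YES distribution $w=Mx$ (over $\mathbb{Z}_r$), under the NO distribution $w$ is uniformly random in $\mathbb{Z}_r^{\alpha n/t}$. After receiving one message from Alice, Bob must decide whether $w$ came from the YES or NO distribution; advantage $\varepsilon$ means success probability at least $1/2+\varepsilon$. *)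

theory Defs
  imports
    "HOL-Probability.Probability_Mass_Function"
    "Jordan_Normal_Form.Schur_Decomposition"
begin

text \<open>
  Elements of \<open>\<int>\<^sub>r\<close> are represented by their residues in \<open>{0..<r}\<close>, and the ground set \<open>[n]\<close>
  by \<open>{..<n}\<close>.
\<close>

definition zr_strings :: "nat \<Rightarrow> nat \<Rightarrow> int vec set" where
  "zr_strings r k = {v \<in> carrier_vec k. \<forall>i<k. vec_index v i \<in> {0..<int r}}"

definition hypermatchings :: "real \<Rightarrow> nat \<Rightarrow> nat \<Rightarrow> nat set list set" where
  "hypermatchings \<alpha> t n =
     {M. real (length M) = \<alpha> * real n / real t \<and>
         (\<forall>e\<in>set M. e \<subseteq> {..<n} \<and> card e = t) \<and>
         (\<forall>i<length M. \<forall>j<length M. i \<noteq> j \<longrightarrow> M ! i \<inter> M ! j = {})}"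

definition incidence_mat :: "nat \<Rightarrow> nat set list \<Rightarrow> int mat" where
  "incidence_mat n M = Matrix.mat (length M) n (\<lambda>(i, j). if j \<in> M ! i then 1 else 0)"

definition hh_label :: "nat \<Rightarrow> nat \<Rightarrow> nat set list \<Rightarrow> int vec \<Rightarrow> int vec" where
  "hh_label r n M x = map_vec (\<lambda>a. a mod int r) (incidence_mat n M *\<^sub>v x)"

text \<open>
  The input triples \<open>(x, M, w)\<close>: in both distributions \<open>x\<close> and \<open>M\<close> are uniform and independent.
\<close>

definition hh_yes :: "nat \<Rightarrow> real \<Rightarrow> nat \<Rightarrow> nat \<Rightarrow> (int vec \<times> nat set list \<times> int vec) pmf" where
  "hh_yes r \<alpha> t n =
     bind_pmf (pmf_of_set (zr_strings r n)) (\<lambda>x.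
     bind_pmf (pmf_of_set (hypermatchings \<alpha> t n)) (\<lambda>M.
     return_pmf (x, M, hh_label r n M x)))"

definition hh_no :: "nat \<Rightarrow> real \<Rightarrow> nat \<Rightarrow> nat \<Rightarrow> (int vec \<times> nat set list \<times> int vec) pmf" where
  "hh_no r \<alpha> t n =
     bind_pmf (pmf_of_set (zr_strings r n)) (\<lambda>x.
     bind_pmf (pmf_of_set (hypermatchings \<alpha> t n)) (\<lambda>M.
     bind_pmf (pmf_of_set (zr_strings r (length M))) (\<lambda>w.
     return_pmf (x, M, w))))"

definition psd_mat :: "nat \<Rightarrow> complex mat \<Rightarrow> bool" where
  "psd_mat d A \<longleftrightarrow> A \<in> carrier_mat d d \<and> mat_adjoint A = A \<and>
     (\<forall>v\<in>carrier_vec d. 0 \<le> Re ((A *\<^sub>v v) \<bullet>c v))"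

definition mat_trace :: "complex mat \<Rightarrow> complex" where
  "mat_trace A = (\<Sum>i<dim_row A. A $$ (i, i))"

definition density_mat :: "nat \<Rightarrow> complex mat \<Rightarrow> bool" where
  "density_mat d \<rho> \<longleftrightarrow> psd_mat d \<rho> \<and> mat_trace \<rho> = 1"

definition binary_povm :: "nat \<Rightarrow> (bool \<Rightarrow> complex mat) \<Rightarrow> bool" where
  "binary_povm d F \<longleftrightarrow> psd_mat d (F True) \<and> psd_mat d (F False) \<and> F True + F False = 1\<^sub>m d"

definition born_prob :: "complex mat \<Rightarrow> complex mat \<Rightarrow> real" where
  "born_prob E \<rho> = Re (mat_trace (E * \<rho>))"

text \<open>
  Alice sends the (possibly mixed) state \<open>message x\<close>; Bob applies the measurement
  \<open>measurement M w\<close>, where outcome \<open>True\<close> means that he answers YES. General quantum operations,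
  ancillas and private randomness of Bob are covered, since they amount to a binary POVM on the
  message.
\<close>

record hh_protocol =
  message :: "int vec \<Rightarrow> complex mat"
  measurement :: "nat set list \<Rightarrow> int vec \<Rightarrow> bool \<Rightarrow> complex mat"

definition one_way_quantum_protocol ::
    "nat \<Rightarrow> real \<Rightarrow> nat \<Rightarrow> nat \<Rightarrow> nat \<Rightarrow> hh_protocol \<Rightarrow> bool" where
  "one_way_quantum_protocol r \<alpha> t n m P \<longleftrightarrow>
     (\<forall>x\<in>zr_strings r n. density_mat (2 ^ m) (message P x)) \<and>
     (\<forall>M\<in>hypermatchings \<alpha> t n. \<forall>w\<in>zr_strings r (length M).
        binary_povm (2 ^ m) (measurement P M w))"

text \<open>The YES and NO distributions each occur with probability 1/2.\<close>

definition success_prob :: "nat \<Rightarrow> real \<Rightarrow> nat \<Rightarrow> nat \<Rightarrow> hh_protocol \<Rightarrow> real" where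
  "success_prob r \<alpha> t n P =
     (measure_pmf.expectation (hh_yes r \<alpha> t n)
        (\<lambda>(x, M, w). born_prob (measurement P M w True) (message P x)) +
      measure_pmf.expectation (hh_no r \<alpha> t n)
        (\<lambda>(x, M, w). born_prob (measurement P M w False) (message P x))) / 2"

definition achieves_advantage ::
    "nat \<Rightarrow> real \<Rightarrow> nat \<Rightarrow> nat \<Rightarrow> hh_protocol \<Rightarrow> real \<Rightarrow> bool" where
  "achieves_advantage r \<alpha> t n P \<epsilon> \<longleftrightarrow> success_prob r \<alpha> t n P \<ge> 1 / 2 + \<epsilon>"

end

(* Bob's advantage is at most half the mean over x of Tr (G x * rho x), where G x averages over the
   matching M the deviation of Bob's YES operator at w = M x from its mean over w. Split G x along the
   Efron-Stein decomposition of Bob's operators; the part of level l is a sum of components indexed by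
   sets K of t * l coordinates, namely the unions of l edges of M, and each component averages to zero
   over any single coordinate of K. Since Tr (H rho)^2 <= Tr (H^2 rho) and Tr (H^2 rho) <= Tr (H^2), the
   q-th power of the level-l contribution (q a power of 2) is at most the mean of Tr (H^q). Expanding
   this moment, only those q-tuples of sets K survive in which no coordinate is covered exactly once, and
   these are few. A given K is a union of l edges of a random matching with probability
   (N choose l) / (n choose (t * l)) by symmetry. The exponent is chosen per level, q about m / l
   for l < 2 m and q = 2 otherwise. *)
theory Submission
  imports Defs
begin

section \<open>Matrices and trace inequalities\<close>

text \<open>The message dimension \<open>2 ^ m\<close> enters a moment as a prefactor, so a q-th
  root turns it into 2 to the power m / q. Level l tolerates a loss exponential in l, which asks for
  q at least of order m / l. A larger q hurts: the root of the number of surviving tuples grows with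
  q, and this growth is where the power of m in the final estimate comes from. Once l is at least 2
  * m the prefactor is harmless even for q = 2, and there the surviving tuples can be counted
  without loss. Restricting q to powers of two keeps the matrix analysis elementary: repeated
  squaring needs only Cauchy-Schwarz for positive forms, no eigenvalues and no Schatten norms. The
  arithmetic mod r is used at a single point: a uniform coordinate makes the label of its edge
  uniform, whatever the other coordinates are. Averages and inclusion-exclusion can therefore
  replace characters, and no constant depends on r. The levels sum geometrically only when the
  first-level estimate is small; when it is large, boundedness of the advantage is enough.\<close>

definition mmul :: "nat \<Rightarrow> (nat \<Rightarrow> nat \<Rightarrow> complex) \<Rightarrow> (nat \<Rightarrow> nat \<Rightarrow> complex) \<Rightarrow> nat \<Rightarrow> nat \<Rightarrow> complex" where
  "mmul d A B = (\<lambda>i j. \<Sum>k<d. A i k * B k j)"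

definition mtr :: "nat \<Rightarrow> (nat \<Rightarrow> nat \<Rightarrow> complex) \<Rightarrow> complex" where
  "mtr d A = (\<Sum>i<d. A i i)"

text \<open>Matrices are functions on index pairs, and only entries below \<open>d\<close> are
  inspected. Sums and averages of matrices are then pointwise, at the price of equalities that hold
  for indices below \<open>d\<close> only.\<close>

definition herm :: "nat \<Rightarrow> (nat \<Rightarrow> nat \<Rightarrow> complex) \<Rightarrow> bool" where
  "herm d A \<longleftrightarrow> (\<forall>i<d. \<forall>j<d. A j i = cnj (A i j))"

definition bform :: "nat \<Rightarrow> (nat \<Rightarrow> nat \<Rightarrow> complex) \<Rightarrow> (nat \<Rightarrow> complex) \<Rightarrow> (nat \<Rightarrow> complex) \<Rightarrow> complex" where
  "bform d A u v = (\<Sum>i<d. \<Sum>j<d. cnj (u i) * A i j * v j)"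

definition psd :: "nat \<Rightarrow> (nat \<Rightarrow> nat \<Rightarrow> complex) \<Rightarrow> bool" where
  "psd d A \<longleftrightarrow> herm d A \<and> (\<forall>v. 0 \<le> Re (bform d A v v))"

definition vnorm :: "nat \<Rightarrow> (nat \<Rightarrow> complex) \<Rightarrow> real" where
  "vnorm d v = L2_set (\<lambda>i. cmod (v i)) {..<d}"

definition mapp :: "nat \<Rightarrow> (nat \<Rightarrow> nat \<Rightarrow> complex) \<Rightarrow> (nat \<Rightarrow> complex) \<Rightarrow> nat \<Rightarrow> complex" where
  "mapp d A v = (\<lambda>i. \<Sum>j<d. A i j * v j)"

text \<open>An upper bound on the operator norm, stated as an inequality so that no supremum has to
  be formed.\<close>

definition opbound :: "nat \<Rightarrow> real \<Rightarrow> (nat \<Rightarrow> nat \<Rightarrow> complex) \<Rightarrow> bool" where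
  "opbound d c A \<longleftrightarrow> (\<forall>v. vnorm d (mapp d A v) \<le> c * vnorm d v)"

primrec mprod :: "nat \<Rightarrow> (nat \<Rightarrow> nat \<Rightarrow> complex) list \<Rightarrow> nat \<Rightarrow> nat \<Rightarrow> complex" where
  "mprod d [] = (\<lambda>i j. if i = j then 1 else 0)"
| "mprod d (A # As) = mmul d A (mprod d As)"

lemma mmul_assoc: "mmul d (mmul d A B) C = mmul d A (mmul d B C)"
proof (intro ext)
  fix i j
  have "mmul d (mmul d A B) C i j = (\<Sum>k<d. \<Sum>l<d. A i l * (B l k * C k j))"
    by (simp add: mmul_def sum_distrib_right mult.assoc)
  also have "\<dots> = (\<Sum>l<d. \<Sum>k<d. A i l * (B l k * C k j))" by (rule sum.swap)
  also have "\<dots> = mmul d A (mmul d B C) i j"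
    by (simp add: mmul_def sum_distrib_left)
  finally show "mmul d (mmul d A B) C i j = mmul d A (mmul d B C) i j" .
qed

lemma mmul_cong:
  "(\<And>k. k < d \<Longrightarrow> A i k = A' i k) \<Longrightarrow> (\<And>k. k < d \<Longrightarrow> B k j = B' k j) \<Longrightarrow> mmul d A B i j = mmul d A' B' i j"
  unfolding mmul_def by (rule sum.cong) auto

lemma mtr_mmul_commute: "mtr d (mmul d A B) = mtr d (mmul d B A)"
  unfolding mtr_def mmul_def by (subst sum.swap) (simp add: mult.commute)

lemma mprod_append:
  assumes "i < d"
  shows "mprod d (As @ Bs) i j = mmul d (mprod d As) (mprod d Bs) i j"
  using assms
proof (induction As arbitrary: i)
  case Nil
  \<comment> \<open>For \<open>i\<close> outside the range, the identity row would vanish at every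
    \<open>k < d\<close>; this is where \<open>i < d\<close> enters.\<close>
  have "(\<Sum>k<d. (if i = k then 1 else 0) * mprod d Bs k j) = (\<Sum>k<d. if k = i then mprod d Bs k j else 0)"
    by (rule sum.cong) auto
  also have "\<dots> = mprod d Bs i j" using Nil by (subst sum.delta) auto
  finally show ?case by (simp add: mmul_def)
next
  case (Cons A As)
  have "mprod d ((A # As) @ Bs) i j = mmul d A (mprod d (As @ Bs)) i j" by simp
  also have "\<dots> = mmul d A (mmul d (mprod d As) (mprod d Bs)) i j"
    by (rule mmul_cong) (use Cons in auto)
  finally show ?case by (simp add: mmul_assoc)
qed

section \<open>Euclidean norms and operator-norm bounds\<close>

lemma vnorm_nonneg: "0 \<le> vnorm d v" by (simp add: vnorm_def)

lemma vnorm_sq: "(vnorm d v)\<^sup>2 = (\<Sum>i<d. (cmod (v i))\<^sup>2)"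
  by (simp add: vnorm_def L2_set_def sum_nonneg)

lemma vnorm_add: "vnorm d (\<lambda>i. u i + v i) \<le> vnorm d u + vnorm d v"
proof -
  have "vnorm d (\<lambda>i. u i + v i) \<le> L2_set (\<lambda>i. cmod (u i) + cmod (v i)) {..<d}"
    unfolding vnorm_def by (rule L2_set_mono) (auto intro: norm_triangle_ineq)
  also have "\<dots> \<le> vnorm d u + vnorm d v"
    unfolding vnorm_def by (rule L2_set_triangle_ineq)
  finally show ?thesis .
qed

lemma vnorm_scale: "vnorm d (\<lambda>i. c * v i) = cmod c * vnorm d v"
  by (simp add: vnorm_def L2_set_def norm_mult power_mult_distrib sum_distrib_left[symmetric] real_sqrt_mult)

lemma opbound_sum:
  assumes "finite S" "\<And>s. s \<in> S \<Longrightarrow> opbound d (c s) (A s)"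
  shows "opbound d (\<Sum>s\<in>S. c s) (\<lambda>i j. \<Sum>s\<in>S. A s i j)"
  using assms
proof (induction S rule: finite_induct)
  case empty
  then show ?case by (simp add: opbound_def mapp_def vnorm_def L2_set_def)
next
  case (insert x S)
  show ?case unfolding opbound_def
  proof
    fix v
    have "mapp d (\<lambda>i j. \<Sum>s\<in>insert x S. A s i j) v =
      (\<lambda>i. mapp d (A x) v i + mapp d (\<lambda>i j. \<Sum>s\<in>S. A s i j) v i)"
      using insert by (simp add: mapp_def fun_eq_iff distrib_right sum.distrib)
    then have "vnorm d (mapp d (\<lambda>i j. \<Sum>s\<in>insert x S. A s i j) v) \<le>
      vnorm d (mapp d (A x) v) + vnorm d (mapp d (\<lambda>i j. \<Sum>s\<in>S. A s i j) v)"
      by (simp only: vnorm_add)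
    also have "\<dots> \<le> c x * vnorm d v + (\<Sum>s\<in>S. c s) * vnorm d v"
      using insert unfolding opbound_def by (intro add_mono) auto
    finally show "vnorm d (mapp d (\<lambda>i j. \<Sum>s\<in>insert x S. A s i j) v) \<le> (\<Sum>s\<in>insert x S. c s) * vnorm d v"
      using insert by (simp add: distrib_right)
  qed
qed

lemma opbound_scale:
  assumes "opbound d c A"
  shows "opbound d (cmod z * c) (\<lambda>i j. z * A i j)"
proof -
  have "mapp d (\<lambda>i j. z * A i j) v = (\<lambda>i. z * mapp d A v i)" for v
    by (simp add: mapp_def sum_distrib_left mult.assoc)
  then show ?thesis using assms
    by (auto simp: opbound_def vnorm_scale mult.assoc intro: mult_left_mono)
qed

lemma opbound_mono: "opbound d c A \<Longrightarrow> c \<le> c' \<Longrightarrow> opbound d c' A"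
  unfolding opbound_def by (meson mult_right_mono order_trans vnorm_nonneg)

lemma opbound_mprod:
  assumes "\<And>A. A \<in> set As \<Longrightarrow> opbound d c A" "0 \<le> c"
  shows "opbound d (c ^ length As) (mprod d As)"
  using assms
proof (induction As)
  case Nil
  have "mapp d (mprod d []) v i = v i" if "i < d" for v i
  proof -
    have "mapp d (mprod d []) v i = (\<Sum>j<d. if j = i then v j else 0)"
      unfolding mapp_def by (rule sum.cong) auto
    then show ?thesis using that by (simp add: sum.delta)
  qed
  then have "vnorm d (mapp d (mprod d []) v) = vnorm d v" for v
    unfolding vnorm_def L2_set_def by simp
  then show ?case by (simp add: opbound_def)
next
  case (Cons A As)
  have eq: "mapp d (mprod d (A # As)) v = mapp d A (mapp d (mprod d As) v)" for v
  proof
    fix i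
    have "mapp d (mprod d (A # As)) v i = (\<Sum>j<d. \<Sum>k<d. A i k * (mprod d As k j * v j))"
      by (simp add: mapp_def mmul_def sum_distrib_right mult.assoc)
    also have "\<dots> = (\<Sum>k<d. \<Sum>j<d. A i k * (mprod d As k j * v j))" by (rule sum.swap)
    also have "\<dots> = mapp d A (mapp d (mprod d As) v) i"
      by (simp add: mapp_def sum_distrib_left)
    finally show "mapp d (mprod d (A # As)) v i = mapp d A (mapp d (mprod d As) v) i" .
  qed
  show ?case unfolding opbound_def
  proof
    fix v
    have "vnorm d (mapp d (mprod d (A # As)) v) \<le> c * vnorm d (mapp d (mprod d As) v)"
      unfolding eq using Cons.prems by (simp add: opbound_def)
    also have "\<dots> \<le> c * (c ^ length As * vnorm d v)"
      using Cons by (intro mult_left_mono) (auto simp: opbound_def)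
    finally show "vnorm d (mapp d (mprod d (A # As)) v) \<le> c ^ length (A # As) * vnorm d v"
      by (simp add: mult.assoc)
  qed
qed

lemma mapp_unit:
  assumes "i < d"
  shows "mapp d A (\<lambda>j. if j = i then 1 else 0) = (\<lambda>k. A k i)"
proof
  fix k
  have "mapp d A (\<lambda>j. if j = i then 1 else 0) k = (\<Sum>j<d. if j = i then A k j else 0)"
    unfolding mapp_def by (rule sum.cong) auto
  then show "mapp d A (\<lambda>j. if j = i then 1 else 0) k = A k i"
    using assms by (simp add: sum.delta)
qed

lemma vnorm_unit: "i < d \<Longrightarrow> vnorm d (\<lambda>j. if j = i then 1 else 0) = 1"
  by (simp add: vnorm_def L2_set_def if_distrib if_distribR sum.delta cong: if_cong)

lemma cmod_le_vnorm: "i < d \<Longrightarrow> cmod (v i) \<le> vnorm d v"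
  unfolding vnorm_def using member_le_L2_set[of "{..<d}" i "\<lambda>i. cmod (v i)"] by simp

text \<open>A diagonal entry is a coordinate of the image of a unit vector, hence at most the norm
  of that image.\<close>

lemma cmod_mtr_le:
  assumes "opbound d c A"
  shows "cmod (mtr d A) \<le> real d * c"
proof -
  have "cmod (mtr d A) \<le> (\<Sum>i<d. cmod (A i i))" unfolding mtr_def by (rule norm_sum)
  also have "\<dots> \<le> (\<Sum>i<d. c)"
  proof (rule sum_mono)
    fix i assume "i \<in> {..<d}"
    then have i: "i < d" by simp
    have "cmod (A i i) \<le> vnorm d (\<lambda>k. A k i)" by (rule cmod_le_vnorm[OF i])
    also have "\<dots> \<le> c * vnorm d (\<lambda>j. if j = i then 1 else 0)"
      using assms unfolding opbound_def mapp_unit[OF i, symmetric] by blast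
    finally show "cmod (A i i) \<le> c" using vnorm_unit[OF i] by simp
  qed
  finally show ?thesis by simp
qed

section \<open>Hermitian and positive semidefinite forms\<close>

lemma hermD: "herm d A \<Longrightarrow> i < d \<Longrightarrow> j < d \<Longrightarrow> cnj (A i j) = A j i"
  unfolding herm_def by metis

lemma bform_cnj:
  assumes "herm d A" shows "bform d A v u = cnj (bform d A u v)"
proof -
  have "bform d A v u = (\<Sum>i<d. \<Sum>j<d. cnj (v j) * A j i * u i)"
    unfolding bform_def by (rule sum.swap)
  also have "\<dots> = cnj (bform d A u v)"
    unfolding bform_def cnj_sum
  proof (intro sum.cong refl)
    fix i j assume "i \<in> {..<d}" "j \<in> {..<d}"
    then show "cnj (v j) * A j i * u i = cnj (cnj (u i) * A i j * v j)"
      by (simp add: hermD[OF assms])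
  qed
  finally show ?thesis .
qed

lemma bform_add_scale:
  "bform d A (\<lambda>i. u i + z * v i) (\<lambda>i. u i + z * v i) =
   bform d A u u + z * bform d A u v + cnj z * bform d A v u + z * cnj z * bform d A v v"
  unfolding bform_def sum_distrib_left sum.distrib[symmetric]
  by (intro sum.cong refl) (simp add: algebra_simps)

text \<open>Discriminant argument: the form at u + z * v is nonnegative, and the choice z = - s *
  cnj b aligns the phases and leaves a quadratic in the real number s.\<close>

lemma psd_cauchy_schwarz:
  assumes "psd d A"
  shows "(cmod (bform d A u v))\<^sup>2 \<le> Re (bform d A u u) * Re (bform d A v v)"
proof -
  define b where "b = bform d A u v"
  define P Q \<beta> where "P = Re (bform d A u u)" and "Q = Re (bform d A v v)" and "\<beta> = (cmod b)\<^sup>2"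
  have h: "herm d A" and pos: "\<And>v. 0 \<le> Re (bform d A v v)" using assms by (auto simp: psd_def)
  have b\<beta>: "b * cnj b = of_real \<beta>" unfolding \<beta>_def by (metis complex_norm_square)
  have key: "0 \<le> P - 2 * s * \<beta> + s\<^sup>2 * \<beta> * Q" for s :: real
  proof -
    define z where "z = - of_real s * cnj b"
    have 1: "z * b = of_real (- s * \<beta>)" using b\<beta> by (simp add: z_def mult.commute mult.left_commute)
    have 2: "cnj z * cnj b = of_real (- s * \<beta>)" using b\<beta> by (simp add: z_def mult.commute mult.left_commute)
    have 3: "z * cnj z = of_real (s\<^sup>2 * \<beta>)" using b\<beta> by (simp add: z_def power2_eq_square mult.commute mult.left_commute)
    have "0 \<le> Re (bform d A u u + z * b + cnj z * cnj b + z * cnj z * bform d A v v)"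
      using pos[of "\<lambda>i. u i + z * v i"] unfolding bform_add_scale bform_cnj[OF h, of v u] b_def by simp
    also have "\<dots> = P - 2 * s * \<beta> + s\<^sup>2 * \<beta> * Q"
      unfolding 1 2 3 P_def Q_def by simp
    finally show ?thesis .
  qed
  have Q0: "0 \<le> Q" and P0: "0 \<le> P" and \<beta>0: "0 \<le> \<beta>" using pos by (auto simp: Q_def P_def \<beta>_def)
  have "\<beta> \<le> P * Q"
  proof (cases "Q = 0")
    case True
    have "\<beta> = 0"
    proof (rule ccontr)
      assume "\<beta> \<noteq> 0"
      \<comment> \<open>With Q = 0 the quadratic is affine in s with slope - 2 * \<beta>; this s
        gives it the value - P - 2.\<close>
      then show False using key[of "(P + 1) / \<beta>"] True P0 \<beta>0 by simp
    qed
    then show ?thesis using True by simp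
  next
    case False
    then have "Q > 0" using Q0 by simp
    \<comment> \<open>The minimiser of the quadratic.\<close>
    then show ?thesis using key[of "1 / Q"] by (simp add: field_simps power2_eq_square)
  qed
  then show ?thesis by (simp add: \<beta>_def P_def Q_def b_def)
qed

lemma bform_mapp: "bform d A u v = (\<Sum>i<d. cnj (u i) * mapp d A v i)"
  by (simp add: bform_def mapp_def sum_distrib_left mult.assoc)

lemma bform_unit:
  assumes "k < d" "l < d"
  shows "bform d A (\<lambda>j. if j = k then 1 else 0) (\<lambda>j. if j = l then 1 else 0) = A k l"
proof -
  have "bform d A (\<lambda>j. if j = k then 1 else 0) (\<lambda>j. if j = l then 1 else 0) =
    (\<Sum>i<d. if i = k then A i l else 0)"
    unfolding bform_mapp mapp_unit[OF assms(2)] by (intro sum.cong refl) auto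
  then show ?thesis using assms by (simp add: sum.delta)
qed

text \<open>The operator inequality A \<le> Tr(A) I, obtained from the 2 x 2 minors and
  Cauchy-Schwarz instead of eigenvalues. For a density matrix it reads R \<le> I.\<close>

lemma psd_bform_le:
  assumes "psd d A"
  shows "Re (bform d A v v) \<le> Re (mtr d A) * (vnorm d v)\<^sup>2"
proof -
  have diag: "0 \<le> Re (A i i)" if "i < d" for i
    using assms bform_unit[OF that that] unfolding psd_def by metis
  have entry: "cmod (A i j) \<le> sqrt (Re (A i i)) * sqrt (Re (A j j))" if "i < d" "j < d" for i j
  proof -
    have "(cmod (A i j))\<^sup>2 \<le> Re (A i i) * Re (A j j)"
      using psd_cauchy_schwarz[OF assms] bform_unit that by metis
    then show ?thesis by (metis real_le_rsqrt real_sqrt_mult)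
  qed
  have "Re (bform d A v v) \<le> cmod (bform d A v v)" by (rule complex_Re_le_cmod)
  also have "\<dots> \<le> (\<Sum>i<d. \<Sum>j<d. cmod (v i) * cmod (A i j) * cmod (v j))"
    unfolding bform_def by (intro sum_norm_le) (auto simp: norm_mult)
  also have "\<dots> \<le> (\<Sum>i<d. \<Sum>j<d. cmod (v i) * (sqrt (Re (A i i)) * sqrt (Re (A j j))) * cmod (v j))"
    by (intro sum_mono mult_right_mono mult_left_mono) (auto simp: entry)
  also have "\<dots> = (\<Sum>i<d. sqrt (Re (A i i)) * cmod (v i))\<^sup>2"
    unfolding power2_eq_square sum_product by (simp add: mult_ac)
  also have "\<dots> \<le> (\<Sum>i<d. (sqrt (Re (A i i)))\<^sup>2) * (\<Sum>i<d. (cmod (v i))\<^sup>2)"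
    by (rule Cauchy_Schwarz_ineq_sum)
  also have "\<dots> = Re (mtr d A) * (vnorm d v)\<^sup>2"
    by (simp add: vnorm_sq mtr_def diag)
  finally show ?thesis .
qed

text \<open>Cauchy-Schwarz for the form of A, applied to the vectors A v and v, turns the quadratic
  bound A \<le> I into a norm bound.\<close>

lemma psd_opbound:
  assumes "psd d A" "\<And>v. Re (bform d A v v) \<le> (vnorm d v)\<^sup>2"
  shows "opbound d 1 A"
  unfolding opbound_def
proof
  fix v
  define u where "u = mapp d A v"
  have b: "bform d A u v = of_real ((vnorm d u)\<^sup>2)"
  proof -
    have "bform d A u v = (\<Sum>i<d. cnj (u i) * u i)"
      by (simp add: bform_mapp u_def)
    also have "\<dots> = (\<Sum>i<d. of_real ((cmod (u i))\<^sup>2))"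
      by (intro sum.cong refl) (metis complex_norm_square mult.commute)
    finally show ?thesis by (simp add: vnorm_sq)
  qed
  have "((vnorm d u)\<^sup>2)\<^sup>2 = (cmod (bform d A u v))\<^sup>2" unfolding b norm_of_real by simp
  also have "\<dots> \<le> Re (bform d A u u) * Re (bform d A v v)" by (rule psd_cauchy_schwarz[OF assms(1)])
  also have "\<dots> \<le> (vnorm d u)\<^sup>2 * (vnorm d v)\<^sup>2"
    using assms by (intro mult_mono) (auto simp: psd_def)
  finally have *: "(vnorm d u)\<^sup>2 * (vnorm d u)\<^sup>2 \<le> (vnorm d u)\<^sup>2 * (vnorm d v)\<^sup>2"
    by (simp add: power2_eq_square)
  show "vnorm d (mapp d A v) \<le> 1 * vnorm d v"
  proof (cases "vnorm d u = 0")
    case True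
    then show ?thesis using vnorm_nonneg by (simp add: u_def)
  next
    case False
    then have "(vnorm d u)\<^sup>2 \<le> (vnorm d v)\<^sup>2" using * by (subst (asm) mult_le_cancel_left_pos) auto
    then show ?thesis using vnorm_nonneg by (simp add: u_def power2_le_iff_abs_le)
  qed
qed

section \<open>Traces against a density matrix\<close>

lemma herm_square: "herm d H \<Longrightarrow> herm d (mmul d H H)"
  unfolding herm_def[of d "mmul d H H"] unfolding mmul_def
  by (auto simp: hermD mult.commute intro!: sum.cong)

text \<open>Makes positivity of R usable one column of H at a time.\<close>

lemma tr_columns:
  assumes "herm d H"
  shows "mtr d (mmul d (mmul d H H) R) = (\<Sum>i<d. bform d R (\<lambda>k. H k i) (\<lambda>k. H k i))"
proof -
  have "mtr d (mmul d (mmul d H H) R) = mtr d (mmul d H (mmul d R H))"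
    by (metis mmul_assoc mtr_mmul_commute)
  also have "\<dots> = (\<Sum>i<d. bform d R (\<lambda>k. H k i) (\<lambda>k. H k i))"
    unfolding mtr_def mmul_def bform_def
    by (intro sum.cong refl) (auto simp: hermD[OF assms] sum_distrib_left mult.assoc intro!: sum.cong)
  finally show ?thesis .
qed

lemma tr_square_mono:
  assumes "herm d H" "psd d R" "mtr d R = 1"
  shows "Re (mtr d (mmul d (mmul d H H) R)) \<le> Re (mtr d (mmul d H H))"
proof -
  have "Re (mtr d (mmul d (mmul d H H) R)) \<le> (\<Sum>i<d. (vnorm d (\<lambda>k. H k i))\<^sup>2)"
    unfolding tr_columns[OF assms(1)] Re_sum
    using psd_bform_le[OF assms(2)] assms(3) by (intro sum_mono) (metis mult_1 one_complex.sel(1))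
  also have "\<dots> = Re (mtr d (mmul d H H))"
    unfolding mtr_def mmul_def vnorm_sq Re_sum
  proof (intro sum.cong refl)
    fix i k assume "i \<in> {..<d}" "k \<in> {..<d}"
    then have "H i k = cnj (H k i)" by (simp add: hermD[OF assms(1)])
    then show "(cmod (H k i))\<^sup>2 = Re (H i k * H k i)"
      by (simp add: cmod_power2) (simp add: power2_eq_square)
  qed
  finally show ?thesis .
qed

text \<open>The variance of the observable H in the state R is nonnegative: Tr ((H - s)^2 R) \<ge> 0
  at the mean s = Tr (H R).\<close>

lemma tr_square_ge:
  assumes "herm d H" "psd d R" "mtr d R = 1"
  shows "(Re (mtr d (mmul d H R)))\<^sup>2 \<le> Re (mtr d (mmul d (mmul d H H) R))"
proof -
  define e :: "nat \<Rightarrow> nat \<Rightarrow> complex" where "e = (\<lambda>i j. if j = i then 1 else 0)"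
  define s where "s = Re (mtr d (mmul d H R))"
  have 1: "bform d R (\<lambda>k. H k i) (e i) = mmul d H R i i" if "i < d" for i
  proof -
    have "bform d R (\<lambda>k. H k i) (e i) = (\<Sum>k<d. cnj (H k i) * R k i)"
      unfolding bform_mapp e_def mapp_unit[OF that] by (rule refl)
    also have "\<dots> = mmul d H R i i" using that
      unfolding mmul_def by (intro sum.cong refl) (simp add: hermD[OF assms(1)])
    finally show ?thesis .
  qed
  have hR: "herm d R" using assms(2) by (simp add: psd_def)
  \<comment> \<open>The vectors are the columns of H - s I, with \<open>e i\<close> the unit
    vectors.\<close>
  have "0 \<le> (\<Sum>i<d. Re (bform d R (\<lambda>k. H k i + - of_real s * e i k) (\<lambda>k. H k i + - of_real s * e i k)))"
    using assms(2) by (intro sum_nonneg) (auto simp: psd_def)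
  also have "\<dots> = (\<Sum>i<d. Re (bform d R (\<lambda>k. H k i) (\<lambda>k. H k i)) - 2 * s * Re (mmul d H R i i) + s\<^sup>2 * Re (R i i))"
  proof (intro sum.cong refl)
    fix i assume "i \<in> {..<d}"
    then have i: "i < d" by simp
    show "Re (bform d R (\<lambda>k. H k i + - of_real s * e i k) (\<lambda>k. H k i + - of_real s * e i k)) =
      Re (bform d R (\<lambda>k. H k i) (\<lambda>k. H k i)) - 2 * s * Re (mmul d H R i i) + s\<^sup>2 * Re (R i i)"
      unfolding bform_add_scale bform_cnj[OF hR, of "e i" "\<lambda>k. H k i"] 1[OF i]
      unfolding e_def bform_unit[OF i i]
      by (simp add: power2_eq_square)
  qed
  also have "\<dots> = Re (mtr d (mmul d (mmul d H H) R)) - 2 * s * s + s\<^sup>2 * Re (mtr d R)"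
    by (simp add: tr_columns[OF assms(1)] s_def mtr_def[of d "mmul d H R"] mtr_def[of d R]
        sum.distrib sum_subtractf sum_distrib_left)
  finally show ?thesis using assms(3) by (simp add: s_def power2_eq_square)
qed

lemma mtr_cong: "(\<And>i. i < d \<Longrightarrow> A i i = B i i) \<Longrightarrow> mtr d A = mtr d B"
  unfolding mtr_def by (rule sum.cong) auto

lemma mprod_single:
  assumes "j < d" shows "mprod d [A] i j = A i j"
proof -
  have "mprod d [A] i j = (\<Sum>k<d. if k = j then A i k else 0)"
    unfolding mprod.simps mmul_def by (rule sum.cong) auto
  then show ?thesis using assms by (simp add: sum.delta)
qed

lemma herm_cong: "(\<And>i j. i < d \<Longrightarrow> j < d \<Longrightarrow> A i j = B i j) \<Longrightarrow> herm d A \<longleftrightarrow> herm d B"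
  unfolding herm_def by metis

lemma herm_mprod_power2: "herm d H \<Longrightarrow> herm d (mprod d (replicate (2 ^ j) H))"
proof (induction j)
  case 0
  have "herm d (mprod d [H]) \<longleftrightarrow> herm d H" by (intro herm_cong mprod_single)
  then show ?case using 0 by simp
next
  case (Suc j)
  let ?Q = "mprod d (replicate (2 ^ j) H)"
  have "mprod d (replicate (2 ^ Suc j) H) i k = mmul d ?Q ?Q i k" if "i < d" for i k
    using mprod_append[OF that, of "replicate (2 ^ j) H" "replicate (2 ^ j) H"]
    by (simp add: replicate_add[symmetric] mult_2)
  then have "herm d (mprod d (replicate (2 ^ Suc j) H)) \<longleftrightarrow> herm d (mmul d ?Q ?Q)"
    by (intro herm_cong)
  then show ?case using Suc herm_square by blast
qed

lemma mean_square_le: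
  fixes f :: "'a \<Rightarrow> real"
  assumes "finite X" "X \<noteq> {}"
  shows "((\<Sum>x\<in>X. f x) / card X)\<^sup>2 \<le> (\<Sum>x\<in>X. (f x)\<^sup>2) / card X"
proof -
  have "(\<Sum>x\<in>X. 1 * f x)\<^sup>2 \<le> (\<Sum>x\<in>X. 1\<^sup>2) * (\<Sum>x\<in>X. (f x)\<^sup>2)"
    by (rule Cauchy_Schwarz_ineq_sum)
  moreover have "card X > 0" using assms by (simp add: card_gt_0_iff)
  ultimately show ?thesis by (simp add: field_simps power2_eq_square)
qed

text \<open>Let a j be the mean of Tr (H^(2^j) R). Both the average over X and the state obey
  Cauchy-Schwarz, so the square of a j is at most a (j + 1). The state is discarded only at the end,
  where the power of H is a square and R \<le> I applies.\<close>

lemma mean_trace_power_le: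
  assumes fin: "finite X" "X \<noteq> {}"
    and H: "\<And>x. x \<in> X \<Longrightarrow> herm d (H x)"
    and R: "\<And>x. x \<in> X \<Longrightarrow> psd d (R x)" "\<And>x. x \<in> X \<Longrightarrow> mtr d (R x) = 1"
  shows "((\<Sum>x\<in>X. Re (mtr d (mmul d (H x) (R x)))) / card X) ^ (2 ^ Suc j)
    \<le> (\<Sum>x\<in>X. Re (mtr d (mprod d (replicate (2 ^ Suc j) (H x))))) / card X"
proof -
  define P where "P = (\<lambda>j x. mprod d (replicate (2 ^ j) (H x)))"
  define a where "a = (\<lambda>j. (\<Sum>x\<in>X. Re (mtr d (mmul d (P j x) (R x)))) / card X)"
  have P0: "mmul d (P 0 x) (R x) i k = mmul d (H x) (R x) i k" for x i k
  proof (rule mmul_cong)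
    fix l assume "l < d"
    show "P 0 x i l = H x i l"
      using mprod_single[OF \<open>l < d\<close>] by (simp add: P_def del: mprod.simps)
  qed simp
  have PS: "P (Suc j) x i k = mmul d (P j x) (P j x) i k" if "i < d" for j x i k
    using mprod_append[OF that, of "replicate (2 ^ j) (H x)" "replicate (2 ^ j) (H x)"]
    by (simp add: P_def replicate_add[symmetric] mult_2)
  have hP: "herm d (P j x)" if "x \<in> X" for j x
    unfolding P_def by (intro herm_mprod_power2 H that)
  have trS: "mtr d (mmul d (P (Suc j) x) (R x)) = mtr d (mmul d (mmul d (P j x) (P j x)) (R x))" for j x
    by (intro mtr_cong mmul_cong) (auto simp: PS)
  have step: "(a j)\<^sup>2 \<le> a (Suc j)" for j
  proof -
    have "(a j)\<^sup>2 \<le> (\<Sum>x\<in>X. (Re (mtr d (mmul d (P j x) (R x))))\<^sup>2) / card X"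
      unfolding a_def by (rule mean_square_le[OF fin])
    also have "\<dots> \<le> a (Suc j)"
      unfolding a_def trS by (intro divide_right_mono sum_mono tr_square_ge hP R) auto
    finally show ?thesis .
  qed
  have pow: "a 0 ^ (2 ^ Suc j) \<le> a (Suc j)" for j
  proof (induction j)
    case 0
    then show ?case using step[of 0] by simp
  next
    case (Suc j)
    have "a 0 ^ (2 ^ Suc (Suc j)) = (a 0 ^ (2 ^ Suc j))\<^sup>2"
      by (simp add: power_mult[symmetric] mult.commute)
    also have "\<dots> \<le> (a (Suc j))\<^sup>2"
    proof (rule power_mono[OF Suc])
      \<comment> \<open>Squaring preserves the inequality only between nonnegative sides, whence the
        even exponent \<open>2 ^ Suc j\<close>.\<close>
      have "even (2 ^ Suc j :: nat)" by simp
      then show "0 \<le> a 0 ^ (2 ^ Suc j)" by (rule zero_le_even_power)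
    qed
    also have "\<dots> \<le> a (Suc (Suc j))" by (rule step)
    finally show ?case .
  qed
  have "a (Suc j) \<le> (\<Sum>x\<in>X. Re (mtr d (P (Suc j) x))) / card X"
  proof -
    have "mtr d (P (Suc j) x) = mtr d (mmul d (P j x) (P j x))" for x
      by (intro mtr_cong) (auto simp: PS)
    then show ?thesis unfolding a_def trS
      by (auto intro!: divide_right_mono sum_mono tr_square_mono hP R)
  qed
  moreover have "a 0 = (\<Sum>x\<in>X. Re (mtr d (mmul d (H x) (R x)))) / card X"
    unfolding a_def by (simp add: P0 mtr_def)
  ultimately show ?thesis using pow[of j] unfolding P_def by simp
qed

section \<open>Moments of sums of centred matrix functions\<close>

definition no_single :: "'a set list \<Rightarrow> bool" where
  "no_single \<kappa> \<longleftrightarrow> (\<forall>j. card {s. s < length \<kappa> \<and> j \<in> \<kappa> ! s} \<noteq> 1)"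

lemma finite_PiE_const: "finite I \<Longrightarrow> finite A \<Longrightarrow> finite (PiE I (\<lambda>_. A))"
  by (rule finite_PiE) auto

text \<open>Resampling one coordinate preserves the uniform distribution: exchanging x j with a is
  an involution on the pairs (x, a).\<close>

lemma sum_PiE_update:
  fixes h :: "('i \<Rightarrow> 'a) \<Rightarrow> 'b::comm_semiring_1"
  assumes "finite I" "finite A" "j \<in> I"
  shows "(\<Sum>x\<in>PiE I (\<lambda>_. A). \<Sum>a\<in>A. h (x(j := a))) = of_nat (card A) * (\<Sum>x\<in>PiE I (\<lambda>_. A). h x)"
proof -
  let ?X = "PiE I (\<lambda>_. A)"
  have fin: "finite ?X" by (rule finite_PiE_const[OF assms(1,2)])
  have "(\<Sum>x\<in>?X. \<Sum>a\<in>A. h (x(j := a))) = (\<Sum>(x,a)\<in>?X \<times> A. h (x(j := a)))"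
    by (rule sum.cartesian_product)
  also have "\<dots> = (\<Sum>(x,a)\<in>?X \<times> A. h x)"
    by (rule sum.reindex_bij_witness[of _ "\<lambda>(x,a). (x(j := a), x j)" "\<lambda>(x,a). (x(j := a), x j)"])
      (use assms(3) in \<open>auto simp: PiE_iff extensional_def\<close>)
  also have "\<dots> = (\<Sum>x\<in>?X. \<Sum>a\<in>A. h x)"
    by (rule sum.cartesian_product[symmetric])
  finally show ?thesis by (simp add: sum_distrib_left)
qed

text \<open>The matrices do not commute, so the expansion runs over ordered lists and not over
  multisets.\<close>

lemma mprod_replicate_sum:
  assumes "finite S"
  shows "mprod d (replicate q (\<lambda>i j. \<Sum>K\<in>S. G K i j)) i j =
    (\<Sum>\<kappa>\<in>{\<kappa>. set \<kappa> \<subseteq> S \<and> length \<kappa> = q}. mprod d (map G \<kappa>) i j)"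
proof (induction q arbitrary: i)
  case 0
  have "{\<kappa>. set \<kappa> \<subseteq> S \<and> length \<kappa> = 0} = {[]}" by auto
  then show ?case by simp
next
  case (Suc q)
  let ?L = "{\<kappa>. set \<kappa> \<subseteq> S \<and> length \<kappa> = q}"
  have "(\<Sum>\<kappa>\<in>{\<kappa>. set \<kappa> \<subseteq> S \<and> length \<kappa> = Suc q}. mprod d (map G \<kappa>) i j) =
     (\<Sum>(\<kappa>,K)\<in>?L \<times> S. mprod d (map G (K # \<kappa>)) i j)"
    unfolding lists_length_Suc_eq
    by (subst sum.reindex) (auto simp: inj_on_def intro!: sum.cong)
  also have "\<dots> = (\<Sum>\<kappa>\<in>?L. \<Sum>K\<in>S. \<Sum>l<d. G K i l * mprod d (map G \<kappa>) l j)"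
    unfolding sum.cartesian_product[symmetric] by (simp add: mmul_def)
  also have "\<dots> = (\<Sum>\<kappa>\<in>?L. \<Sum>l<d. \<Sum>K\<in>S. G K i l * mprod d (map G \<kappa>) l j)"
    by (intro sum.cong refl sum.swap)
  also have "\<dots> = (\<Sum>l<d. \<Sum>\<kappa>\<in>?L. \<Sum>K\<in>S. G K i l * mprod d (map G \<kappa>) l j)"
    by (rule sum.swap)
  also have "\<dots> = (\<Sum>l<d. (\<Sum>K\<in>S. G K i l) * (\<Sum>\<kappa>\<in>?L. mprod d (map G \<kappa>) l j))"
    by (simp add: sum_product sum.swap[of _ S])
  also have "\<dots> = mprod d (replicate (Suc q) (\<lambda>i j. \<Sum>K\<in>S. G K i j)) i j"
    by (simp add: mmul_def Suc)
  finally show ?case by simp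
qed

lemma sum_mprod_insert_zero:
  assumes "i < d" and zero: "\<And>k l. (\<Sum>a\<in>A. B a k l) = 0"
  shows "(\<Sum>a\<in>A. mprod d (As @ B a # Cs) i j) = 0"
proof -
  have "(\<Sum>a\<in>A. mprod d (As @ B a # Cs) i j) =
    (\<Sum>a\<in>A. \<Sum>k<d. \<Sum>l<d. mprod d As i k * (B a k l * mprod d Cs l j))"
    by (simp only: mprod_append[OF assms(1)] mprod.simps) (simp add: mmul_def sum_distrib_left)
  also have "\<dots> = (\<Sum>k<d. \<Sum>a\<in>A. \<Sum>l<d. mprod d As i k * (B a k l * mprod d Cs l j))"
    by (rule sum.swap)
  also have "\<dots> = (\<Sum>k<d. \<Sum>l<d. \<Sum>a\<in>A. mprod d As i k * (B a k l * mprod d Cs l j))"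
    by (intro sum.cong refl sum.swap)
  also have "\<dots> = (\<Sum>k<d. \<Sum>l<d. mprod d As i k * ((\<Sum>a\<in>A. B a k l) * mprod d Cs l j))"
    by (simp add: sum_distrib_left sum_distrib_right)
  finally show ?thesis by (simp add: zero)
qed

lemma not_no_single_split:
  assumes "\<not> no_single \<kappa>"
  obtains j \<kappa>1 K \<kappa>2 where "\<kappa> = \<kappa>1 @ K # \<kappa>2" "j \<in> K" "\<And>K'. K' \<in> set \<kappa>1 \<union> set \<kappa>2 \<Longrightarrow> j \<notin> K'"
proof -
  obtain j where "card {s. s < length \<kappa> \<and> j \<in> \<kappa> ! s} = 1" using assms by (auto simp: no_single_def)
  then obtain s where s: "{s. s < length \<kappa> \<and> j \<in> \<kappa> ! s} = {s}" by (auto simp: card_1_singleton_iff)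
  then have sl: "s < length \<kappa>" "j \<in> \<kappa> ! s" by auto
  have other: "j \<notin> \<kappa> ! s'" if "s' < length \<kappa>" "s' \<noteq> s" for s'
  proof
    assume "j \<in> \<kappa> ! s'"
    then have "s' \<in> {s. s < length \<kappa> \<and> j \<in> \<kappa> ! s}" using that by simp
    then show False using s that by simp
  qed
  show ?thesis
  proof
    show "\<kappa> = take s \<kappa> @ \<kappa> ! s # drop (Suc s) \<kappa>" using sl by (simp add: id_take_nth_drop)
    show "j \<in> \<kappa> ! s" by fact
    fix K' assume "K' \<in> set (take s \<kappa>) \<union> set (drop (Suc s) \<kappa>)"
    then consider "K' \<in> set (take s \<kappa>)" | "K' \<in> set (drop (Suc s) \<kappa>)" by blast
    then show "j \<notin> K'"
    proof cases
      case 1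
      then obtain i where "i < length (take s \<kappa>)" "take s \<kappa> ! i = K'" by (metis in_set_conv_nth)
      then show ?thesis using other[of i] sl by auto
    next
      case 2
      then obtain i where "i < length (drop (Suc s) \<kappa>)" "drop (Suc s) \<kappa> ! i = K'" by (metis in_set_conv_nth)
      then show ?thesis using other[of "Suc s + i"] sl by auto
    qed
  qed
qed

text \<open>If j lies in exactly one set of the list, resampling x j changes one factor of the
  matrix product and nothing else. The product is linear in that factor, whose sum over the values
  of x j is zero.\<close>

lemma moment_bound:
  fixes G :: "'i set \<Rightarrow> ('i \<Rightarrow> 'a) \<Rightarrow> nat \<Rightarrow> nat \<Rightarrow> complex"
  assumes fin: "finite I" "finite A" "A \<noteq> {}" "finite S" "\<And>K. K \<in> S \<Longrightarrow> K \<subseteq> I"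
    and indep: "\<And>K x j a. K \<in> S \<Longrightarrow> x \<in> PiE I (\<lambda>_. A) \<Longrightarrow> j \<in> I - K \<Longrightarrow> a \<in> A \<Longrightarrow> G K (x(j := a)) = G K x"
    and mean0: "\<And>K x j k l. K \<in> S \<Longrightarrow> x \<in> PiE I (\<lambda>_. A) \<Longrightarrow> j \<in> K \<Longrightarrow> (\<Sum>a\<in>A. G K (x(j := a)) k l) = 0"
    and bound: "\<And>K x. K \<in> S \<Longrightarrow> x \<in> PiE I (\<lambda>_. A) \<Longrightarrow> opbound d c (G K x)" and c0: "0 \<le> c"
  shows "cmod (\<Sum>x\<in>PiE I (\<lambda>_. A). mtr d (mprod d (replicate q (\<lambda>i j. \<Sum>K\<in>S. G K x i j))))
    \<le> card {\<kappa>. (set \<kappa> \<subseteq> S \<and> length \<kappa> = q) \<and> no_single \<kappa>} * (card (PiE I (\<lambda>_. A)) * (real d * c ^ q))"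
proof -
  let ?X = "PiE I (\<lambda>_. A)" and ?L = "{\<kappa>. set \<kappa> \<subseteq> S \<and> length \<kappa> = q}"
  let ?P = "\<lambda>\<kappa> x. mprod d (map (\<lambda>K. G K x) \<kappa>)"
  have finL: "finite ?L" using fin(4) by (rule finite_lists_length_eq)
  have vanish: "(\<Sum>x\<in>?X. ?P \<kappa> x i l) = 0" if \<kappa>: "\<kappa> \<in> ?L" "\<not> no_single \<kappa>" and i: "i < d" for \<kappa> i l
  proof -
    obtain j \<kappa>1 K \<kappa>2 where sp: "\<kappa> = \<kappa>1 @ K # \<kappa>2" "j \<in> K" "\<And>K'. K' \<in> set \<kappa>1 \<union> set \<kappa>2 \<Longrightarrow> j \<notin> K'"
      using not_no_single_split[OF \<kappa>(2)] by metis
    have K: "K \<in> S" "j \<in> I" using \<kappa>(1) sp fin(5) by auto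
    have "(\<Sum>a\<in>A. ?P \<kappa> (x(j := a)) i l) = 0" if x: "x \<in> ?X" for x
    proof -
      have "map (\<lambda>K. G K (x(j := a))) \<kappa> = map (\<lambda>K. G K x) \<kappa>1 @ G K (x(j := a)) # map (\<lambda>K. G K x) \<kappa>2"
        if "a \<in> A" for a
      proof -
        have "G K' (x(j := a)) = G K' x" if "K' \<in> set \<kappa>1 \<union> set \<kappa>2" for K'
          using \<kappa>(1) sp K that x \<open>a \<in> A\<close> by (intro indep) auto
        then show ?thesis unfolding sp(1) by simp
      qed
      then have "(\<Sum>a\<in>A. ?P \<kappa> (x(j := a)) i l) =
        (\<Sum>a\<in>A. mprod d (map (\<lambda>K. G K x) \<kappa>1 @ G K (x(j := a)) # map (\<lambda>K. G K x) \<kappa>2) i l)"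
        by (intro sum.cong refl) simp
      also have "\<dots> = 0" by (rule sum_mprod_insert_zero[OF i]) (rule mean0[OF K(1) x sp(2)])
      finally show ?thesis .
    qed
    \<comment> \<open>Resampling j in every summand multiplies the full sum by \<open>card A\<close>
      only, so vanishing inner sums force the full sum to vanish.\<close>
    then have "of_nat (card A) * (\<Sum>x\<in>?X. ?P \<kappa> x i l) = 0"
      unfolding sum_PiE_update[OF fin(1,2) K(2), symmetric] by simp
    then show ?thesis using fin(2,3) by simp
  qed
  have "(\<Sum>x\<in>?X. mtr d (mprod d (replicate q (\<lambda>i j. \<Sum>K\<in>S. G K x i j)))) =
    (\<Sum>x\<in>?X. \<Sum>i<d. \<Sum>\<kappa>\<in>?L. ?P \<kappa> x i i)"
    unfolding mtr_def by (subst mprod_replicate_sum[OF fin(4)]) (rule refl)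
  also have "\<dots> = (\<Sum>x\<in>?X. \<Sum>\<kappa>\<in>?L. \<Sum>i<d. ?P \<kappa> x i i)"
    by (intro sum.cong refl sum.swap)
  also have "\<dots> = (\<Sum>\<kappa>\<in>?L. \<Sum>x\<in>?X. mtr d (?P \<kappa> x))"
    unfolding mtr_def by (rule sum.swap)
  also have "\<dots> = (\<Sum>\<kappa>\<in>{\<kappa>\<in>?L. no_single \<kappa>}. \<Sum>x\<in>?X. mtr d (?P \<kappa> x))"
  proof (rule sum.mono_neutral_right[OF finL])
    show "\<forall>\<kappa>\<in>?L - {\<kappa> \<in> ?L. no_single \<kappa>}. (\<Sum>x\<in>?X. mtr d (?P \<kappa> x)) = 0"
    proof
      fix \<kappa> assume \<kappa>: "\<kappa> \<in> ?L - {\<kappa> \<in> ?L. no_single \<kappa>}"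
      have "(\<Sum>x\<in>?X. mtr d (?P \<kappa> x)) = (\<Sum>i<d. \<Sum>x\<in>?X. ?P \<kappa> x i i)"
        unfolding mtr_def by (rule sum.swap)
      also have "\<dots> = 0" using \<kappa> by (intro sum.neutral) (auto intro!: vanish)
      finally show "(\<Sum>x\<in>?X. mtr d (?P \<kappa> x)) = 0" .
    qed
  qed auto
  finally have eq: "(\<Sum>x\<in>?X. mtr d (mprod d (replicate q (\<lambda>i j. \<Sum>K\<in>S. G K x i j)))) =
    (\<Sum>\<kappa>\<in>{\<kappa>\<in>?L. no_single \<kappa>}. \<Sum>x\<in>?X. mtr d (?P \<kappa> x))" .
  \<comment> \<open>Each survivor is estimated by the dimension times the product of norms;
    cancellation among survivors is not exploited.\<close>
  have "cmod (\<Sum>\<kappa>\<in>{\<kappa>\<in>?L. no_single \<kappa>}. \<Sum>x\<in>?X. mtr d (?P \<kappa> x)) \<le>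
    (\<Sum>\<kappa>\<in>{\<kappa>\<in>?L. no_single \<kappa>}. \<Sum>x\<in>?X. real d * c ^ q)"
  proof (intro sum_norm_le)
    fix \<kappa> x assume \<kappa>: "\<kappa> \<in> {\<kappa>\<in>?L. no_single \<kappa>}" and x: "x \<in> ?X"
    have "opbound d (c ^ length (map (\<lambda>K. G K x) \<kappa>)) (?P \<kappa> x)"
      using \<kappa> x bound c0 by (intro opbound_mprod) auto
    then show "cmod (mtr d (?P \<kappa> x)) \<le> real d * c ^ q" using \<kappa> cmod_mtr_le by auto
  qed
  also have "\<dots> = card {\<kappa>\<in>?L. no_single \<kappa>} * (card ?X * (real d * c ^ q))" by simp
  finally show ?thesis unfolding eq by simp
qed

section \<open>Counting the surviving tuples\<close>

lemma no_single_card_Union: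
  assumes "no_single \<kappa>" "\<And>K. K \<in> set \<kappa> \<Longrightarrow> finite K \<and> card K = k"
  shows "2 * card (\<Union>(set \<kappa>)) \<le> k * length \<kappa>"
proof -
  let ?U = "\<Union>(set \<kappa>)"
  have finU: "finite ?U" using assms(2) by auto
  have ge2: "2 \<le> card {s. s < length \<kappa> \<and> j \<in> \<kappa> ! s}" if "j \<in> ?U" for j
  proof -
    have "card {s. s < length \<kappa> \<and> j \<in> \<kappa> ! s} \<noteq> 0" using that by (auto simp: in_set_conv_nth)
    then show ?thesis using assms(1) unfolding no_single_def by (metis One_nat_def less_2_cases not_less)
  qed
  \<comment> \<open>Double counting of incidences: each point of the union lies in at least two
    members of the list.\<close>
  have "2 * card ?U = (\<Sum>j\<in>?U. 2)" by simp
  also have "\<dots> \<le> (\<Sum>j\<in>?U. card {s. s < length \<kappa> \<and> j \<in> \<kappa> ! s})" by (intro sum_mono ge2)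
  also have "\<dots> = (\<Sum>j\<in>?U. \<Sum>s<length \<kappa>. if j \<in> \<kappa> ! s then 1 else 0)"
    by (intro sum.cong refl) (simp add: sum.If_cases Int_def lessThan_def)
  also have "\<dots> = (\<Sum>s<length \<kappa>. \<Sum>j\<in>?U. if j \<in> \<kappa> ! s then 1 else 0)" by (rule sum.swap)
  also have "\<dots> = (\<Sum>s<length \<kappa>. card (\<kappa> ! s))"
  proof (intro sum.cong refl)
    fix s assume "s \<in> {..<length \<kappa>}"
    then have "\<kappa> ! s \<in> set \<kappa>" by simp
    then have "?U \<inter> \<kappa> ! s = \<kappa> ! s" by blast
    then show "(\<Sum>j\<in>?U. if j \<in> \<kappa> ! s then 1 else 0) = card (\<kappa> ! s)"
      using finU by (simp add: sum.If_cases Int_def[symmetric] Collect_mem_eq)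
  qed
  also have "\<dots> = (\<Sum>s<length \<kappa>. k)" using assms(2) by (intro sum.cong refl) auto
  finally show ?thesis by (simp add: mult.commute)
qed

text \<open>Two sets without a singly covered point coincide. The estimate for lists of general even
  length exceeds this count by a factor of at least exp k, which the highest levels cannot
  absorb.\<close>

lemma card_no_single_two:
  assumes "finite I"
  shows "card {\<kappa>. (set \<kappa> \<subseteq> {K. K \<subseteq> I \<and> card K = k} \<and> length \<kappa> = 2) \<and> no_single \<kappa>} \<le> card I choose k"
proof -
  let ?S = "{K. K \<subseteq> I \<and> card K = k}"
  have "{\<kappa>. (set \<kappa> \<subseteq> ?S \<and> length \<kappa> = 2) \<and> no_single \<kappa>} \<subseteq> (\<lambda>K. [K, K]) ` ?S"
  proof
    fix \<kappa> assume \<kappa>: "\<kappa> \<in> {\<kappa>. (set \<kappa> \<subseteq> ?S \<and> length \<kappa> = 2) \<and> no_single \<kappa>}"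
    then obtain K K' where eq: "\<kappa> = [K, K']" by (auto simp: numeral_2_eq_2 length_Suc_conv)
    have "j \<in> K \<longleftrightarrow> j \<in> K'" for j
    proof (rule ccontr)
      assume "\<not> ?thesis"
      then have "{s. s < length \<kappa> \<and> j \<in> \<kappa> ! s} = {if j \<in> K then 0 else 1}"
        unfolding eq by (auto simp: less_Suc_eq)
      then have "card {s. s < length \<kappa> \<and> j \<in> \<kappa> ! s} = 1" by simp
      then show False using \<kappa> by (auto simp: no_single_def)
    qed
    then show "\<kappa> \<in> (\<lambda>K. [K, K]) ` ?S" using \<kappa> eq by auto
  qed
  then have "card {\<kappa>. (set \<kappa> \<subseteq> ?S \<and> length \<kappa> = 2) \<and> no_single \<kappa>} \<le> card ?S"
    using assms by (intro surj_card_le) auto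
  then show ?thesis using n_subsets[OF assms, of k] by simp
qed

text \<open>One term of the exponential series.\<close>

lemma power_self_le_exp_fact: "real u ^ u \<le> exp (real u) * fact u"
proof -
  have "(\<Sum>i\<in>{u}. real u ^ i /\<^sub>R fact i) \<le> exp (real u)"
    unfolding exp_def by (rule sum_le_suminf) (simp_all add: summable_exp)
  then show ?thesis by (simp add: field_simps)
qed

lemma binomial_le_pow_fact: "real (n choose k) \<le> real n ^ k / fact k"
  using binomial_fact_pow[of n k]
  by (simp add: field_simps) (metis of_nat_fact of_nat_le_iff of_nat_mult of_nat_power)

text \<open>
  The sets of such a list lie in a common set of \<open>u\<close> points; for \<open>u > n\<close> all lists are counted.
\<close>

lemma card_no_single_le:
  assumes "finite I" and n: "n = card I" and u: "u = k * p"
  shows "real (card {\<kappa>. (set \<kappa> \<subseteq> {K. K \<subseteq> I \<and> card K = k} \<and> length \<kappa> = 2 * p) \<and> no_single \<kappa>})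
    \<le> (exp 1 * real n * real u) ^ u / fact k ^ (2 * p)"
proof -
  let ?S = "\<lambda>I. {K. K \<subseteq> I \<and> card K = k}"
  let ?L = "\<lambda>I. {\<kappa>. set \<kappa> \<subseteq> ?S I \<and> length \<kappa> = 2 * p}"
  let ?C = "{\<kappa>. (set \<kappa> \<subseteq> ?S I \<and> length \<kappa> = 2 * p) \<and> no_single \<kappa>}"
  have cardL: "card (?L U) = (card U choose k) ^ (2 * p)" if "finite U" for U
    using that by (subst card_lists_length_eq) (auto simp: n_subsets)
  have finL: "finite (?L U)" if "finite U" for U
    using that by (intro finite_lists_length_eq) auto
  have uu: "k * (2 * p) = u + u" using u by simp
  show ?thesis
  proof (cases "u \<le> n")
    case True
    have "?C \<subseteq> (\<Union>U\<in>{U. U \<subseteq> I \<and> card U = u}. ?L U)"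
    proof
      fix \<kappa> assume \<kappa>: "\<kappa> \<in> ?C"
      have fK: "finite K \<and> card K = k" if "K \<in> set \<kappa>" for K
      proof -
        have "K \<in> ?S I" using \<kappa> that by auto
        then show ?thesis using finite_subset[of K I] assms(1) by simp
      qed
      have "2 * card (\<Union>(set \<kappa>)) \<le> k * length \<kappa>"
        using \<kappa> fK by (intro no_single_card_Union) auto
      then have "card (\<Union>(set \<kappa>)) \<le> u" using \<kappa> u by simp
      moreover have "\<Union>(set \<kappa>) \<subseteq> I" using \<kappa> by auto
      ultimately obtain U where "\<Union>(set \<kappa>) \<subseteq> U" "U \<subseteq> I" "card U = u"
        using True n exists_subset_between[of "\<Union>(set \<kappa>)" u I] assms(1) by auto
      moreover from this have "set \<kappa> \<subseteq> ?S U" using \<kappa> by auto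
      ultimately show "\<kappa> \<in> (\<Union>U\<in>{U. U \<subseteq> I \<and> card U = u}. ?L U)" using \<kappa> by blast
    qed
    then have "card ?C \<le> card (\<Union>U\<in>{U. U \<subseteq> I \<and> card U = u}. ?L U)"
      using assms(1) by (intro card_mono finite_UN_I finL) (auto intro: rev_finite_subset)
    also have "\<dots> \<le> (\<Sum>U\<in>{U. U \<subseteq> I \<and> card U = u}. card (?L U))"
      using assms(1) by (intro card_UN_le) auto
    also have "\<dots> = (\<Sum>U\<in>{U. U \<subseteq> I \<and> card U = u}. (u choose k) ^ (2 * p))"
    proof (intro sum.cong refl)
      fix U assume "U \<in> {U. U \<subseteq> I \<and> card U = u}"
      then have "finite U" "card U = u" using finite_subset[OF _ assms(1), of U] by simp_all
      then show "card (?L U) = (u choose k) ^ (2 * p)" using cardL by blast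
    qed
    also have "\<dots> = (n choose u) * (u choose k) ^ (2 * p)"
      by (simp only: sum_constant n_subsets[OF assms(1)] n of_nat_id)
    finally have "real (card ?C) \<le> real (n choose u) * real (u choose k) ^ (2 * p)"
      by (simp only: of_nat_mult[symmetric] of_nat_power[symmetric] of_nat_le_iff)
    \<comment> \<open>The powers of \<open>fact k\<close> are kept: together with the binomial
      \<open>n choose k\<close> of the norm bound they will form falling factorials.\<close>
    also have "\<dots> \<le> (real n ^ u / fact u) * (real u ^ k / fact k) ^ (2 * p)"
      by (intro mult_mono power_mono binomial_le_pow_fact) auto
    also have "\<dots> = real n ^ u * real u ^ u * (real u ^ u / fact u) / fact k ^ (2 * p)"
    proof -
      have "(real u ^ k) ^ (2 * p) = real u ^ u * real u ^ u"
        by (simp only: power_mult[symmetric] power_add[symmetric] uu)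
      then show ?thesis by (simp add: power_divide)
    qed
    also have "\<dots> \<le> real n ^ u * real u ^ u * exp (real u) / fact k ^ (2 * p)"
      using power_self_le_exp_fact[of u]
      by (intro divide_right_mono mult_left_mono) (auto simp: field_simps)
    also have "\<dots> = (exp 1 * real n * real u) ^ u / fact k ^ (2 * p)"
      by (simp add: power_mult_distrib exp_of_nat_mult[symmetric])
    finally show ?thesis .
  next
    case False
    have "card ?C \<le> card (?L I)" using finL[OF assms(1)] by (intro card_mono) auto
    then have "real (card ?C) \<le> real (n choose k) ^ (2 * p)"
      unfolding cardL[OF assms(1)] n by (simp only: of_nat_power[symmetric] of_nat_le_iff)
    also have "\<dots> \<le> (real n ^ k / fact k) ^ (2 * p)"
      by (intro power_mono binomial_le_pow_fact) auto
    also have "\<dots> = (real n * real n) ^ u / fact k ^ (2 * p)"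
      by (simp only: power_divide power_mult[symmetric] power_mult_distrib power_add[symmetric] uu)
    also have "\<dots> \<le> (exp 1 * real n * real u) ^ u / fact k ^ (2 * p)"
    proof (intro divide_right_mono power_mono)
      have "real n * real n \<le> real n * real u" using False by (intro mult_left_mono) auto
      also have "\<dots> \<le> exp 1 * (real n * real u)"
        using mult_right_mono[of 1 "exp 1" "real n * real u"] by simp
      finally show "real n * real n \<le> exp 1 * real n * real u" by (simp add: mult.assoc)
    qed auto
    finally show ?thesis .
  qed
qed

section \<open>The Efron-Stein decomposition\<close>

text \<open>
  In \<open>override_on w' w T'\<close> the coordinates of \<open>w\<close> in \<open>T'\<close> are kept and all others are resampled.
\<close>

definition efron_stein :: "'i set \<Rightarrow> 'a set \<Rightarrow> (('i \<Rightarrow> 'a) \<Rightarrow> complex) \<Rightarrow> 'i set \<Rightarrow> ('i \<Rightarrow> 'a) \<Rightarrow> complex" where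
  "efron_stein I A F T w = (\<Sum>w'\<in>PiE I (\<lambda>_. A). \<Sum>T'\<in>Pow T. (-1) ^ card (T - T') * F (override_on w' w T'))
     / of_nat (card (PiE I (\<lambda>_. A)))"

lemma override_on_PiE:
  "w \<in> PiE I (\<lambda>_. A) \<Longrightarrow> w' \<in> PiE I (\<lambda>_. A) \<Longrightarrow> override_on w' w T \<in> PiE I (\<lambda>_. A)"
  by (auto simp: override_on_def PiE_iff extensional_def)

lemma card_PiE_const_pos: "finite I \<Longrightarrow> finite A \<Longrightarrow> A \<noteq> {} \<Longrightarrow> card (PiE I (\<lambda>_. A)) > 0"
  by (simp add: card_PiE card_gt_0_iff)

lemma sum_Pow_split:
  assumes "finite T" "i \<in> T"
  shows "(\<Sum>T'\<in>Pow T. h T') = (\<Sum>T'\<in>Pow (T - {i}). h T' + h (insert i T'))"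
proof -
  have T: "T = insert i (T - {i})" using assms(2) by auto
  have "(\<Sum>T'\<in>Pow T. h T') = (\<Sum>T'\<in>Pow (T - {i}) \<union> insert i ` Pow (T - {i}). h T')"
    by (subst T) (simp only: Pow_insert)
  also have "\<dots> = (\<Sum>T'\<in>Pow (T - {i}). h T') + (\<Sum>T'\<in>insert i ` Pow (T - {i}). h T')"
    using assms(1) by (intro sum.union_disjoint) auto
  also have "(\<Sum>T'\<in>insert i ` Pow (T - {i}). h T') = (\<Sum>T'\<in>Pow (T - {i}). h (insert i T'))"
    by (subst sum.reindex) (auto simp: inj_on_def)
  finally show ?thesis by (simp add: sum.distrib)
qed

text \<open>Moebius inversion on the subset lattice: toggling a point outside T' pairs sets of
  opposite sign.\<close>

lemma sum_alternating_interval: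
  assumes "finite I" "T' \<subseteq> I"
  shows "(\<Sum>T\<in>{T\<in>Pow I. T' \<subseteq> T}. (-1) ^ card (T - T')) = (if T' = I then 1 else 0 :: complex)"
proof -
  have "(\<Sum>T\<in>{T\<in>Pow I. T' \<subseteq> T}. (-1) ^ card (T - T')) = (\<Sum>U\<in>Pow (I - T'). (-1 :: complex) ^ card U)"
    by (rule sum.reindex_bij_witness[of _ "\<lambda>U. U \<union> T'" "\<lambda>T. T - T'"])
      (use assms in \<open>auto simp: Un_Diff Diff_triv Un_absorb2 Diff_disjoint\<close>)
  also have "\<dots> = (if T' = I then 1 else 0)"
  proof (cases "T' = I")
    case False
    then obtain i where i: "i \<in> I - T'" using assms by auto
    have "(-1 :: complex) ^ card U + (-1) ^ card (insert i U) = 0" if "U \<in> Pow (I - T' - {i})" for U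
    proof -
      have "finite U" "i \<notin> U" using that assms(1) by (auto intro: rev_finite_subset)
      then show ?thesis by simp
    qed
    then show ?thesis using assms(1) i False by (subst sum_Pow_split[of _ i]) auto
  qed simp
  finally show ?thesis .
qed

text \<open>For each fixed resampling w', Moebius inversion leaves only T' = I, where every
  coordinate of w is kept.\<close>

lemma sum_efron_stein:
  assumes "finite I" "finite A" "A \<noteq> {}" and w: "w \<in> PiE I (\<lambda>_. A)"
  shows "(\<Sum>T\<in>Pow I. efron_stein I A F T w) = F w"
proof -
  let ?X = "PiE I (\<lambda>_. A)"
  let ?g = "\<lambda>w' T T'. (-1) ^ card (T - T') * F (override_on w' w T')"
  have inner: "(\<Sum>T\<in>Pow I. \<Sum>T'\<in>Pow T. ?g w' T T') = F w" if w': "w' \<in> ?X" for w'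
  proof -
    have "(\<Sum>T\<in>Pow I. \<Sum>T'\<in>Pow T. ?g w' T T') = (\<Sum>T\<in>Pow I. \<Sum>T'\<in>{T'\<in>Pow I. T' \<subseteq> T}. ?g w' T T')"
      by (intro sum.cong refl) auto
    also have "\<dots> = (\<Sum>T'\<in>Pow I. \<Sum>T\<in>{T\<in>Pow I. T' \<subseteq> T}. ?g w' T T')"
      using assms(1) by (intro sum.swap_restrict) auto
    also have "\<dots> = (\<Sum>T'\<in>Pow I. (if T' = I then F (override_on w' w T') else 0))"
    proof (intro sum.cong refl)
      fix T' assume "T' \<in> Pow I"
      then have "T' \<subseteq> I" by simp
      show "(\<Sum>T\<in>{T\<in>Pow I. T' \<subseteq> T}. ?g w' T T') = (if T' = I then F (override_on w' w T') else 0)"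
        unfolding sum_distrib_right[symmetric] sum_alternating_interval[OF assms(1) \<open>T' \<subseteq> I\<close>] by simp
    qed
    also have "\<dots> = F (override_on w' w I)" using assms(1) by (simp add: sum.delta)
    also have "override_on w' w I = w"
      using w w' by (auto simp: override_on_def fun_eq_iff PiE_iff extensional_def)
    finally show ?thesis .
  qed
  have "(\<Sum>T\<in>Pow I. efron_stein I A F T w) = (\<Sum>T\<in>Pow I. \<Sum>w'\<in>?X. \<Sum>T'\<in>Pow T. ?g w' T T') / of_nat (card ?X)"
    unfolding efron_stein_def by (rule sum_divide_distrib[symmetric])
  also have "(\<Sum>T\<in>Pow I. \<Sum>w'\<in>?X. \<Sum>T'\<in>Pow T. ?g w' T T') = (\<Sum>w'\<in>?X. \<Sum>T\<in>Pow I. \<Sum>T'\<in>Pow T. ?g w' T T')"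
    by (rule sum.swap)
  also have "\<dots> = of_nat (card ?X) * F w" using inner by simp
  finally show ?thesis using card_PiE_const_pos[OF assms(1-3)] by simp
qed

lemma efron_stein_empty: "efron_stein I A F {} w = (\<Sum>w'\<in>PiE I (\<lambda>_. A). F w') / of_nat (card (PiE I (\<lambda>_. A)))"
  by (simp add: efron_stein_def)

lemma efron_stein_cong:
  assumes "\<And>i. i \<in> T \<Longrightarrow> w i = v i"
  shows "efron_stein I A F T w = efron_stein I A F T v"
proof -
  have "override_on w' w T' = override_on w' v T'" if "T' \<in> Pow T" for w' T'
    using that by (auto simp: override_on_def fun_eq_iff intro: assms)
  then show ?thesis unfolding efron_stein_def by simp
qed

text \<open>A subset T' without i is paired with \<open>insert i T'\<close>, which carries the
  opposite sign. Keeping coordinate i at the value a is the same as resampling it to a, so the two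
  terms cancel after summing over a and w'.\<close>

lemma efron_stein_mean_zero:
  assumes "finite I" "finite A" "T \<subseteq> I" "i \<in> T"
  shows "(\<Sum>a\<in>A. efron_stein I A F T (w(i := a))) = 0"
proof -
  let ?X = "PiE I (\<lambda>_. A)"
  have finT: "finite T" using assms(1,3) by (rule rev_finite_subset)
  define s :: "'a set \<Rightarrow> complex" where "s = (\<lambda>T'. (-1) ^ card (T - insert i T'))"
  have pair: "(\<Sum>T'\<in>Pow T. (-1) ^ card (T - T') * F (override_on w' (w(i := a)) T')) =
      (\<Sum>T'\<in>Pow (T - {i}). s T' * F (override_on (w'(i := a)) w T') - s T' * F (override_on w' w T'))" for w' a
  proof -
    have "(-1) ^ card (T - T') * F (override_on w' (w(i := a)) T') +
       (-1) ^ card (T - insert i T') * F (override_on w' (w(i := a)) (insert i T')) =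
       s T' * F (override_on (w'(i := a)) w T') - s T' * F (override_on w' w T')" if T': "T' \<in> Pow (T - {i})" for T'
    proof -
      have "T - T' = insert i (T - insert i T')" using T' assms(4) by auto
      then have 1: "card (T - T') = Suc (card (T - insert i T'))"
        using finT by (metis Diff_iff card_insert_disjoint finite_Diff insertI1)
      have 2: "override_on w' (w(i := a)) T' = override_on w' w T'"
        using T' by (auto simp: override_on_def fun_eq_iff)
      have 3: "override_on w' (w(i := a)) (insert i T') = override_on (w'(i := a)) w T'"
        using T' by (auto simp: override_on_def fun_eq_iff)
      show ?thesis unfolding 1 2 3 s_def by simp
    qed
    then show ?thesis unfolding sum_Pow_split[OF finT assms(4)] by (intro sum.cong refl)
  qed
  have swap: "(\<Sum>a\<in>A. \<Sum>w'\<in>?X. \<Sum>T'\<in>Pow (T - {i}). h a w' T') =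
     (\<Sum>T'\<in>Pow (T - {i}). \<Sum>w'\<in>?X. \<Sum>a\<in>A. h a w' T')" for h :: "'b \<Rightarrow> ('a \<Rightarrow> 'b) \<Rightarrow> 'a set \<Rightarrow> complex"
  proof -
    have "(\<Sum>a\<in>A. \<Sum>w'\<in>?X. \<Sum>T'\<in>Pow (T - {i}). h a w' T') =
       (\<Sum>a\<in>A. \<Sum>T'\<in>Pow (T - {i}). \<Sum>w'\<in>?X. h a w' T')"
      by (intro sum.cong refl sum.swap)
    also have "\<dots> = (\<Sum>T'\<in>Pow (T - {i}). \<Sum>a\<in>A. \<Sum>w'\<in>?X. h a w' T')" by (rule sum.swap)
    also have "\<dots> = (\<Sum>T'\<in>Pow (T - {i}). \<Sum>w'\<in>?X. \<Sum>a\<in>A. h a w' T')"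
      by (intro sum.cong refl sum.swap)
    finally show ?thesis .
  qed
  have i: "i \<in> I" using assms by auto
  have "(\<Sum>a\<in>A. efron_stein I A F T (w(i := a))) =
    (\<Sum>a\<in>A. \<Sum>w'\<in>?X. \<Sum>T'\<in>Pow (T - {i}). s T' * F (override_on (w'(i := a)) w T') - s T' * F (override_on w' w T'))
     / of_nat (card ?X)"
    unfolding efron_stein_def pair by (rule sum_divide_distrib[symmetric])
  also have "\<dots> = (\<Sum>T'\<in>Pow (T - {i}). (\<Sum>w'\<in>?X. \<Sum>a\<in>A. s T' * F (override_on (w'(i := a)) w T'))
      - (\<Sum>w'\<in>?X. \<Sum>a\<in>A. s T' * F (override_on w' w T'))) / of_nat (card ?X)"
    unfolding swap by (simp only: sum_subtractf)
  also have "\<dots> = 0"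
    unfolding sum_PiE_update[OF assms(1,2) i, where h = "\<lambda>v. s _ * F (override_on v w _)"]
    by (simp add: sum_distrib_left)
  finally show ?thesis .
qed

text \<open>One signed average of matrices of norm at most one for each subset of T. The
  decomposition is scalar-valued and is applied to a matrix function entry by entry.\<close>

lemma efron_stein_opbound:
  assumes "finite I" "finite A" "A \<noteq> {}" "finite T" and w: "w \<in> PiE I (\<lambda>_. A)"
    and F: "\<And>w. w \<in> PiE I (\<lambda>_. A) \<Longrightarrow> opbound d 1 (F w)"
  shows "opbound d (2 ^ card T) (\<lambda>i j. efron_stein I A (\<lambda>w. F w i j) T w)"
proof -
  let ?X = "PiE I (\<lambda>_. A)"
  have fin: "finite ?X" by (rule finite_PiE_const[OF assms(1,2)])
  define z :: "'a set \<Rightarrow> complex" where "z = (\<lambda>T'. (-1) ^ card (T - T') / of_nat (card ?X))"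
  have "opbound d (\<Sum>p\<in>?X \<times> Pow T. 1 / card ?X) (\<lambda>i j. \<Sum>p\<in>?X \<times> Pow T. z (snd p) * F (override_on (fst p) w (snd p)) i j)"
  proof (rule opbound_sum)
    fix p assume p: "p \<in> ?X \<times> Pow T"
    have "opbound d (cmod (z (snd p)) * 1) (\<lambda>i j. z (snd p) * F (override_on (fst p) w (snd p)) i j)"
      using p w by (intro opbound_scale F override_on_PiE) auto
    then show "opbound d (1 / card ?X) (\<lambda>i j. z (snd p) * F (override_on (fst p) w (snd p)) i j)"
      by (simp add: z_def norm_divide norm_power)
  qed (use fin assms(4) in auto)
  moreover have "(\<Sum>p\<in>?X \<times> Pow T. 1 / card ?X) = 2 ^ card T"
    using card_PiE_const_pos[OF assms(1-3)] assms(4) by (simp add: card_cartesian_product card_Pow)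
  moreover have "(\<lambda>i j. \<Sum>p\<in>?X \<times> Pow T. z (snd p) * F (override_on (fst p) w (snd p)) i j) =
    (\<lambda>i j. efron_stein I A (\<lambda>w. F w i j) T w)"
    unfolding efron_stein_def z_def sum_divide_distrib sum.cartesian_product by (auto simp: fun_eq_iff case_prod_beta intro!: sum.cong)
  ultimately show ?thesis by simp
qed

lemma efron_stein_cnj: "cnj (efron_stein I A F T w) = efron_stein I A (\<lambda>w. cnj (F w)) T w"
  by (simp add: efron_stein_def)

lemma efron_stein_fun_cong:
  assumes "w \<in> PiE I (\<lambda>_. A)" "\<And>w. w \<in> PiE I (\<lambda>_. A) \<Longrightarrow> F w = F' w"
  shows "efron_stein I A F T w = efron_stein I A F' T w"
  unfolding efron_stein_def using assms override_on_PiE[of w I A] by (simp cong: sum.cong)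

section \<open>Random hypermatchings\<close>

text \<open>\<open>hypermatchings\<close> with the number of edges given as a natural number instead
  of through \<alpha>.\<close>

definition hmatch :: "nat \<Rightarrow> nat \<Rightarrow> nat \<Rightarrow> nat set list set" where
  "hmatch n t N = {M. length M = N \<and> (\<forall>e\<in>set M. e \<subseteq> {..<n} \<and> card e = t) \<and>
     (\<forall>i<N. \<forall>j<N. i \<noteq> j \<longrightarrow> M ! i \<inter> M ! j = {})}"

definition edge_labels :: "nat \<Rightarrow> nat \<Rightarrow> nat set list \<Rightarrow> (nat \<Rightarrow> int) \<Rightarrow> nat \<Rightarrow> int" where
  "edge_labels r N M x = (\<lambda>i\<in>{..<N}. (\<Sum>j\<in>M ! i. x j) mod int r)"

text \<open>
  The component indexed by \<open>K\<close> collects those of Bob's operators for sets \<open>T\<close> of \<open>l\<close> edges with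
  union \<open>K\<close>: it depends on \<open>x\<close> only through the coordinates in \<open>K\<close>.
\<close>

definition level_part :: "nat \<Rightarrow> nat \<Rightarrow> nat \<Rightarrow> nat \<Rightarrow> (nat set list \<Rightarrow> (nat \<Rightarrow> int) \<Rightarrow> nat \<Rightarrow> nat \<Rightarrow> complex) \<Rightarrow>
    nat \<Rightarrow> nat set \<Rightarrow> (nat \<Rightarrow> int) \<Rightarrow> nat \<Rightarrow> nat \<Rightarrow> complex" where
  "level_part r n t N F l K x i j =
     (\<Sum>M\<in>hmatch n t N. \<Sum>T\<in>{T\<in>{T. T \<subseteq> {..<N} \<and> card T = l}. (\<Union>e\<in>T. M ! e) = K}.
        efron_stein {..<N} {0..<int r} (\<lambda>w. F M w i j) T (edge_labels r N M x)) / of_nat (card (hmatch n t N))"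

lemma finite_hmatch: "finite (hmatch n t N)"
  by (rule finite_subset[OF _ finite_lists_length_eq[of "Pow {..<n}" N]]) (auto simp: hmatch_def)

lemma edge_labels_PiE: "r > 0 \<Longrightarrow> edge_labels r N M x \<in> PiE {..<N} (\<lambda>_. {0..<int r})"
  by (auto simp: edge_labels_def)

lemma hmatch_edge:
  assumes "M \<in> hmatch n t N" "i < N"
  shows "M ! i \<subseteq> {..<n}" "card (M ! i) = t" "finite (M ! i)"
proof -
  have "M ! i \<in> set M" using assms by (auto simp: hmatch_def)
  then show 1: "M ! i \<subseteq> {..<n}" and "card (M ! i) = t" using assms(1) by (auto simp: hmatch_def)
  show "finite (M ! i)" by (rule finite_subset[OF 1]) simp
qed

lemma hmatch_disjoint:
  "M \<in> hmatch n t N \<Longrightarrow> i < N \<Longrightarrow> j < N \<Longrightarrow> i \<noteq> j \<Longrightarrow> M ! i \<inter> M ! j = {}"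
  by (auto simp: hmatch_def)

lemma hmatch_card_Union:
  assumes "M \<in> hmatch n t N" "T \<subseteq> {..<N}"
  shows "card (\<Union>e\<in>T. M ! e) = t * card T" "(\<Union>e\<in>T. M ! e) \<subseteq> {..<n}"
proof -
  have "card (\<Union>e\<in>T. M ! e) = (\<Sum>e\<in>T. card (M ! e))"
  proof (intro card_UN_disjoint ballI impI)
    show "finite T" using assms(2) finite_subset by blast
    show "finite (M ! e)" if "e \<in> T" for e using that assms hmatch_edge(3) by blast
    show "M ! e \<inter> M ! e' = {}" if "e \<in> T" "e' \<in> T" "e \<noteq> e'" for e e'
      using that assms by (intro hmatch_disjoint[OF assms(1)]) auto
  qed
  also have "\<dots> = (\<Sum>e\<in>T. t)"
    using assms hmatch_edge(2)[OF assms(1)] by (intro sum.cong) auto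
  finally show "card (\<Union>e\<in>T. M ! e) = t * card T" by simp
  show "(\<Union>e\<in>T. M ! e) \<subseteq> {..<n}"
    using assms hmatch_edge(1)[OF assms(1)] by blast
qed

lemma bij_extending_subsets:
  assumes "finite V" "K \<subseteq> V" "K' \<subseteq> V" "card K = card K'"
  obtains \<pi> where "bij_betw \<pi> V V" "\<pi> ` K = K'"
proof -
  have fin: "finite K" "finite K'" using assms by (auto intro: rev_finite_subset)
  obtain f where f: "bij_betw f K K'" using finite_same_card_bij[OF fin assms(4)] by blast
  have "card (V - K) = card (V - K')" using assms fin by (simp add: card_Diff_subset)
  then obtain g where g: "bij_betw g (V - K) (V - K')"
    using finite_same_card_bij[of "V - K" "V - K'"] assms(1) by auto
  define \<pi> where "\<pi> = (\<lambda>x. if x \<in> K then f x else g x)"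
  have 1: "bij_betw \<pi> K K'" using f by (rule bij_betw_cong[THEN iffD1, rotated]) (simp add: \<pi>_def)
  have 2: "bij_betw \<pi> (V - K) (V - K')" using g by (rule bij_betw_cong[THEN iffD1, rotated]) (simp add: \<pi>_def)
  have "bij_betw \<pi> (K \<union> (V - K)) (K' \<union> (V - K'))" using 1 2 by (rule bij_betw_combine) auto
  then have "bij_betw \<pi> V V" using assms(2,3) by (simp add: Un_absorb1)
  moreover have "\<pi> ` K = K'" using 1 by (simp add: bij_betw_def)
  ultimately show ?thesis by (rule that)
qed

lemma hmatch_image:
  assumes "bij_betw \<pi> {..<n} {..<n}" "M \<in> hmatch n t N"
  shows "map ((`) \<pi>) M \<in> hmatch n t N"
proof -
  have inj: "inj_on \<pi> {..<n}" and im: "\<pi> ` {..<n} = {..<n}" using assms(1) by (auto simp: bij_betw_def)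
  have "\<pi> ` (M ! i) \<inter> \<pi> ` (M ! j) = {}" if "i < N" "j < N" "i \<noteq> j" for i j
    using inj_on_image_Int[OF inj hmatch_edge(1)[OF assms(2) that(1)] hmatch_edge(1)[OF assms(2) that(2)]]
      hmatch_disjoint[OF assms(2) that] by simp
  moreover have "\<pi> ` e \<subseteq> {..<n} \<and> card (\<pi> ` e) = t" if "e \<in> set M" for e
  proof -
    have e: "e \<subseteq> {..<n}" "card e = t" using that assms(2) by (auto simp: hmatch_def)
    then show ?thesis using card_image[OF inj_on_subset[OF inj e(1)]] im by auto
  qed
  ultimately show ?thesis using assms(2) by (auto simp: hmatch_def)
qed

text \<open>Symmetry: a permutation of the ground set taking K to K' acts on ordered matchings,
  keeps edge positions, and injects the class of K into that of K'. The classes of different sets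
  are disjoint, so the class of K has at most its proportional share.\<close>

lemma card_hmatch_Union:
  assumes T: "T \<subseteq> {..<N}" and K: "K \<subseteq> {..<n}" "card K = k"
  shows "(n choose k) * card {M \<in> hmatch n t N. (\<Union>e\<in>T. M ! e) = K} \<le> card (hmatch n t N)"
proof -
  define S where "S = {K. K \<subseteq> {..<n} \<and> card K = k}"
  define C where "C = (\<lambda>K. {M \<in> hmatch n t N. (\<Union>e\<in>T. M ! e) = K})"
  have finC: "finite (C K)" for K unfolding C_def using finite_hmatch by auto
  have le: "card (C K) \<le> card (C K')" if K': "K' \<in> S" for K'
  proof -
    obtain \<pi> where \<pi>: "bij_betw \<pi> {..<n} {..<n}" "\<pi> ` K = K'"
      using bij_extending_subsets[of "{..<n}" K K'] K K' unfolding S_def by auto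
    have inj: "inj_on \<pi> {..<n}" using \<pi>(1) by (simp add: bij_betw_def)
    have "inj_on (map ((`) \<pi>)) (C K)"
    proof (rule inj_onI)
      fix M M' assume M: "M \<in> C K" "M' \<in> C K" and eq: "map ((`) \<pi>) M = map ((`) \<pi>) M'"
      have "inj_on ((`) \<pi>) (set M \<union> set M')"
      proof (rule inj_onI)
        fix e e' assume "e \<in> set M \<union> set M'" "e' \<in> set M \<union> set M'" "\<pi> ` e = \<pi> ` e'"
        moreover have "e \<subseteq> {..<n}" if "e \<in> set M \<union> set M'" for e
          using that M by (auto simp: C_def hmatch_def)
        ultimately show "e = e'" using inj by (simp add: inj_on_image_eq_iff)
      qed
      then show "M = M'" using eq by (simp add: inj_on_map_eq_map)
    qed
    moreover have "map ((`) \<pi>) ` C K \<subseteq> C K'"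
    proof
      fix M' assume "M' \<in> map ((`) \<pi>) ` C K"
      then obtain M where M: "M \<in> C K" "M' = map ((`) \<pi>) M" by blast
      have len: "length M = N" using M(1) by (simp add: C_def hmatch_def)
      have "(\<Union>e\<in>T. M' ! e) = (\<Union>e\<in>T. \<pi> ` (M ! e))"
        using M(2) len T by (intro SUP_cong refl) auto
      also have "\<dots> = \<pi> ` (\<Union>e\<in>T. M ! e)" by (simp add: image_UN)
      also have "\<dots> = K'" using M(1) \<pi>(2) by (simp add: C_def)
      finally show "M' \<in> C K'" using M hmatch_image[OF \<pi>(1)] by (simp add: C_def)
    qed
    ultimately show ?thesis using finC by (rule card_inj_on_le)
  qed
  have finS: "finite S" unfolding S_def by auto
  have "(n choose k) * card (C K) = (\<Sum>K'\<in>S. card (C K))"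
    unfolding S_def using n_subsets[of "{..<n}" k] by simp
  also have "\<dots> \<le> (\<Sum>K'\<in>S. card (C K'))" by (intro sum_mono le)
  also have "\<dots> = card (\<Union>K'\<in>S. C K')"
    by (intro card_UN_disjoint[symmetric] finS) (auto simp: finC, auto simp: C_def)
  also have "\<dots> \<le> card (hmatch n t N)"
    by (intro card_mono finite_hmatch) (auto simp: C_def)
  finally show ?thesis unfolding C_def .
qed

section \<open>Independence, centring and norms of the level components\<close>

lemma level_part_indep:
  assumes "j \<notin> K"
  shows "level_part r n t N F l K (x(j := a)) = level_part r n t N F l K x"
proof -
  have "efron_stein {..<N} {0..<int r} (\<lambda>w. F M w p q) T (edge_labels r N M (x(j := a))) =
      efron_stein {..<N} {0..<int r} (\<lambda>w. F M w p q) T (edge_labels r N M x)"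
    if "T \<in> {T\<in>{T. T \<subseteq> {..<N} \<and> card T = l}. (\<Union>e\<in>T. M ! e) = K}" for M T p q
  proof (rule efron_stein_cong)
    fix i assume i: "i \<in> T"
    then have "j \<notin> M ! i" using that assms by auto
    then have "(\<Sum>k\<in>M ! i. (x(j := a)) k) = (\<Sum>k\<in>M ! i. x k)" by (intro sum.cong) auto
    then show "edge_labels r N M (x(j := a)) i = edge_labels r N M x i" by (simp add: edge_labels_def)
  qed
  then show ?thesis unfolding level_part_def fun_eq_iff
    by (intro allI arg_cong2[where f = "(/)"] sum.cong refl)
qed

lemma bij_betw_add_mod:
  assumes "r > 0"
  shows "bij_betw (\<lambda>a. (s + a) mod int r) {0..<int r} {0..<int r}"
  by (rule bij_betw_byWitness[where f' = "\<lambda>a. (a - s) mod int r"])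
    (use assms in \<open>auto simp: mod_simps\<close>)

text \<open>The coordinate j lies in one edge i of T. As x j runs through the residues so does the
  label of i, by a shift, while disjointness fixes all other labels. The sum over x j becomes a sum
  over one label, which annihilates the Efron-Stein component.\<close>

lemma level_part_mean_zero:
  assumes r: "r > 0" and x: "x \<in> PiE {..<n} (\<lambda>_. {0..<int r})" and j: "j \<in> K"
  shows "(\<Sum>a\<in>{0..<int r}. level_part r n t N F l K (x(j := a)) p q) = 0"
proof -
  let ?TS = "\<lambda>M. {T\<in>{T. T \<subseteq> {..<N} \<and> card T = l}. (\<Union>e\<in>T. M ! e) = K}"
  let ?es = "\<lambda>M T. efron_stein {..<N} {0..<int r} (\<lambda>w. F M w p q) T"
  have zero: "(\<Sum>a\<in>{0..<int r}. ?es M T (edge_labels r N M (x(j := a)))) = 0"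
    if M: "M \<in> hmatch n t N" and T: "T \<in> ?TS M" for M T
  proof -
    obtain i where i: "i \<in> T" "j \<in> M ! i" using T j by auto
    have iN: "i < N" and TN: "T \<subseteq> {..<N}" using i T by auto
    define s where "s = (\<Sum>k\<in>M ! i - {j}. x k)"
    have lab: "edge_labels r N M (x(j := a)) = (edge_labels r N M x)(i := (s + a) mod int r)" for a
    proof
      fix k
      show "edge_labels r N M (x(j := a)) k = ((edge_labels r N M x)(i := (s + a) mod int r)) k"
      proof (cases "k = i")
        case True
        have "(\<Sum>k\<in>M ! i. (x(j := a)) k) = a + (\<Sum>k\<in>M ! i - {j}. (x(j := a)) k)"
          using sum.remove[OF hmatch_edge(3)[OF M iN] i(2), of "x(j := a)"] by simp
        also have "(\<Sum>k\<in>M ! i - {j}. (x(j := a)) k) = s" unfolding s_def by (intro sum.cong) auto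
        finally show ?thesis using True iN by (simp add: edge_labels_def add.commute)
      next
        case False
        have "(\<Sum>k\<in>M ! k. (x(j := a)) k) = (\<Sum>k\<in>M ! k. x k)" if "k < N"
        proof (intro sum.cong refl)
          fix l assume "l \<in> M ! k"
          then have "l \<noteq> j" using hmatch_disjoint[OF M that iN False] i(2) by auto
          then show "(x(j := a)) l = x l" by simp
        qed
        then show ?thesis using False by (simp add: edge_labels_def)
      qed
    qed
    have "(\<Sum>a\<in>{0..<int r}. ?es M T ((edge_labels r N M x)(i := (s + a) mod int r))) =
       (\<Sum>a\<in>{0..<int r}. ?es M T ((edge_labels r N M x)(i := a)))"
      using bij_betw_add_mod[OF r] by (rule sum.reindex_bij_betw)
    also have "\<dots> = 0" using i(1) TN by (intro efron_stein_mean_zero) auto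
    finally show ?thesis unfolding lab .
  qed
  have "(\<Sum>a\<in>{0..<int r}. level_part r n t N F l K (x(j := a)) p q) =
    (\<Sum>a\<in>{0..<int r}. \<Sum>M\<in>hmatch n t N. \<Sum>T\<in>?TS M. ?es M T (edge_labels r N M (x(j := a)))) / of_nat (card (hmatch n t N))"
    unfolding level_part_def by (rule sum_divide_distrib[symmetric])
  also have "(\<Sum>a\<in>{0..<int r}. \<Sum>M\<in>hmatch n t N. \<Sum>T\<in>?TS M. ?es M T (edge_labels r N M (x(j := a)))) =
    (\<Sum>M\<in>hmatch n t N. \<Sum>a\<in>{0..<int r}. \<Sum>T\<in>?TS M. ?es M T (edge_labels r N M (x(j := a))))"
    by (rule sum.swap)
  also have "\<dots> = (\<Sum>M\<in>hmatch n t N. \<Sum>T\<in>?TS M. \<Sum>a\<in>{0..<int r}. ?es M T (edge_labels r N M (x(j := a))))"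
    by (intro sum.cong refl sum.swap)
  also have "\<dots> = (\<Sum>M\<in>hmatch n t N. \<Sum>T\<in>?TS M. 0)" by (intro sum.cong refl zero)
  finally show ?thesis by (simp only: sum.neutral_const div_0)
qed

text \<open>Each Efron-Stein component has norm at most 2^l. The other factor bounds the expected
  number of sets T of l edges with union K: summing over M first, symmetry gives every T the same
  estimate.\<close>

lemma level_part_opbound:
  assumes r: "r > 0" and K: "K \<subseteq> {..<n}" "card K = k" and tl: "k \<le> n"
    and ne: "hmatch n t N \<noteq> {}"
    and F: "\<And>M w. M \<in> hmatch n t N \<Longrightarrow> w \<in> PiE {..<N} (\<lambda>_. {0..<int r}) \<Longrightarrow> opbound d 1 (F M w)"
  shows "opbound d (2 ^ l * real (N choose l) / real (n choose k)) (level_part r n t N F l K x)"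
proof -
  let ?H = "hmatch n t N"
  let ?Tl = "{T. T \<subseteq> {..<N} \<and> card T = l}"
  let ?TS = "\<lambda>M. {T\<in>?Tl. (\<Union>e\<in>T. M ! e) = K}"
  have finTl: "finite ?Tl" by auto
  have Hpos: "real (card ?H) > 0" using ne finite_hmatch by (simp add: card_gt_0_iff)
  have npos: "real (n choose k) > 0" using tl by simp
  have 1: "opbound d (\<Sum>M\<in>?H. \<Sum>T\<in>?TS M. 2 ^ l)
    (\<lambda>i j. \<Sum>M\<in>?H. \<Sum>T\<in>?TS M. efron_stein {..<N} {0..<int r} (\<lambda>w. F M w i j) T (edge_labels r N M x))"
  proof (intro opbound_sum finite_hmatch)
    fix M T assume M: "M \<in> ?H" and T: "T \<in> ?TS M"
    have "finite T" "card T = l" using T by (auto intro: rev_finite_subset[of "{..<N}"])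
    then show "opbound d (2 ^ l) (\<lambda>i j. efron_stein {..<N} {0..<int r} (\<lambda>w. F M w i j) T (edge_labels r N M x))"
      using efron_stein_opbound[of "{..<N}" "{0..<int r}" T "edge_labels r N M x" d "F M"] F[OF M] edge_labels_PiE[OF r] r by auto
  qed auto
  have 2: "opbound d (cmod (1 / of_nat (card ?H)) * (\<Sum>M\<in>?H. \<Sum>T\<in>?TS M. 2 ^ l)) (level_part r n t N F l K x)"
    using opbound_scale[OF 1, of "1 / of_nat (card ?H)"] unfolding level_part_def by simp
  have "real (\<Sum>M\<in>?H. card (?TS M)) = (\<Sum>M\<in>?H. \<Sum>T\<in>?TS M. 1)" by simp
  also have "\<dots> = (\<Sum>T\<in>?Tl. \<Sum>M\<in>{M\<in>?H. (\<Union>e\<in>T. M ! e) = K}. 1)"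
    by (rule sum.swap_restrict[OF finite_hmatch finTl])
  also have "\<dots> \<le> (\<Sum>T\<in>?Tl. real (card ?H) / real (n choose k))"
  proof (intro sum_mono)
    fix T assume "T \<in> ?Tl"
    then have "(n choose k) * card {M \<in> ?H. (\<Union>e\<in>T. M ! e) = K} \<le> card ?H"
      using K by (intro card_hmatch_Union) auto
    then have "real (n choose k) * real (card {M \<in> ?H. (\<Union>e\<in>T. M ! e) = K}) \<le> real (card ?H)"
      by (simp only: of_nat_mult[symmetric] of_nat_le_iff)
    then show "(\<Sum>M\<in>{M\<in>?H. (\<Union>e\<in>T. M ! e) = K}. 1) \<le> real (card ?H) / real (n choose k)"
      using npos by (simp add: field_simps)
  qed
  also have "\<dots> = real (N choose l) * (real (card ?H) / real (n choose k))"
    using n_subsets[of "{..<N}" l] by simp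
  finally have 3: "real (\<Sum>M\<in>?H. card (?TS M)) \<le> real (N choose l) * (real (card ?H) / real (n choose k))" .
  have "cmod (1 / of_nat (card ?H)) * (\<Sum>M\<in>?H. \<Sum>T\<in>?TS M. 2 ^ l) = 2 ^ l * real (\<Sum>M\<in>?H. card (?TS M)) / real (card ?H)"
    by (simp add: norm_divide sum_distrib_left mult.commute sum_divide_distrib)
  also have "\<dots> \<le> 2 ^ l * (real (N choose l) * (real (card ?H) / real (n choose k))) / real (card ?H)"
    using 3 Hpos by (intro divide_right_mono mult_left_mono) auto
  also have "\<dots> = 2 ^ l * real (N choose l) / real (n choose k)" using Hpos by simp
  finally show ?thesis using 2 opbound_mono by blast
qed

lemma level_part_herm:
  assumes r: "r > 0"
    and F: "\<And>M w. M \<in> hmatch n t N \<Longrightarrow> w \<in> PiE {..<N} (\<lambda>_. {0..<int r}) \<Longrightarrow> herm d (F M w)"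
  shows "herm d (level_part r n t N F l K x)"
  unfolding herm_def
proof (intro allI impI)
  fix i j assume ij: "i < d" "j < d"
  have "efron_stein {..<N} {0..<int r} (\<lambda>w. F M w j i) T (edge_labels r N M x) =
    cnj (efron_stein {..<N} {0..<int r} (\<lambda>w. F M w i j) T (edge_labels r N M x))" if "M \<in> hmatch n t N" for M T
    unfolding efron_stein_cnj using hermD[OF F[OF that]] ij by (intro efron_stein_fun_cong edge_labels_PiE r) auto
  then show "level_part r n t N F l K x j i = cnj (level_part r n t N F l K x i j)"
    unfolding level_part_def by (simp add: cnj_sum)
qed

text \<open>Level 0 consists of T = {} alone and equals the mean over w, so omitting it compares the
  true label with a uniform one. Every T is counted under exactly one K, its union.\<close>

lemma sum_level_part:
  assumes r: "r > 0"
  shows "(\<Sum>l\<in>{1..N}. \<Sum>K\<in>{K. K \<subseteq> {..<n} \<and> card K = t * l}. level_part r n t N F l K x i j) =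
    (\<Sum>M\<in>hmatch n t N. F M (edge_labels r N M x) i j
       - (\<Sum>w\<in>PiE {..<N} (\<lambda>_. {0..<int r}). F M w i j) / of_nat (card (PiE {..<N} (\<lambda>_. {0..<int r}))))
     / of_nat (card (hmatch n t N))"
proof -
  let ?H = "hmatch n t N" and ?A = "{0..<int r}"
  let ?Tl = "\<lambda>l. {T. T \<subseteq> {..<N} \<and> card T = l}"
  let ?S = "\<lambda>l. {K. K \<subseteq> {..<n} \<and> card K = t * l}"
  let ?es = "\<lambda>M T. efron_stein {..<N} ?A (\<lambda>w. F M w i j) T (edge_labels r N M x)"
  have lev: "(\<Sum>K\<in>?S l. level_part r n t N F l K x i j) = (\<Sum>M\<in>?H. \<Sum>T\<in>?Tl l. ?es M T) / of_nat (card ?H)" for l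
  proof -
    have "(\<Sum>K\<in>?S l. level_part r n t N F l K x i j) =
      (\<Sum>K\<in>?S l. \<Sum>M\<in>?H. \<Sum>T\<in>{T\<in>?Tl l. (\<Union>e\<in>T. M ! e) = K}. ?es M T) / of_nat (card ?H)"
      unfolding level_part_def by (rule sum_divide_distrib[symmetric])
    also have "(\<Sum>K\<in>?S l. \<Sum>M\<in>?H. \<Sum>T\<in>{T\<in>?Tl l. (\<Union>e\<in>T. M ! e) = K}. ?es M T) =
      (\<Sum>M\<in>?H. \<Sum>K\<in>?S l. \<Sum>T\<in>{T\<in>?Tl l. (\<Union>e\<in>T. M ! e) = K}. ?es M T)" by (rule sum.swap)
    also have "\<dots> = (\<Sum>M\<in>?H. \<Sum>T\<in>?Tl l. ?es M T)"
    proof (rule sum.cong[OF refl], rule sum.group)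
      fix M assume M: "M \<in> ?H"
      show "(\<lambda>T. \<Union>e\<in>T. M ! e) ` ?Tl l \<subseteq> ?S l"
      proof (rule image_subsetI)
        fix T assume "T \<in> ?Tl l"
        then show "(\<Union>e\<in>T. M ! e) \<in> ?S l" using hmatch_card_Union[OF M, of T] by simp
      qed
    qed auto
    finally show ?thesis .
  qed
  have all: "(\<Sum>l\<in>{1..N}. \<Sum>T\<in>?Tl l. ?es M T) = F M (edge_labels r N M x) i j
       - (\<Sum>w\<in>PiE {..<N} (\<lambda>_. ?A). F M w i j) / of_nat (card (PiE {..<N} (\<lambda>_. ?A)))" for M
  proof -
    have "(\<Sum>l\<in>{0..N}. \<Sum>T\<in>{T\<in>Pow {..<N}. card T = l}. ?es M T) = (\<Sum>T\<in>Pow {..<N}. ?es M T)"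
      by (rule sum.group) (auto dest: card_mono[rotated])
    also have "\<dots> = F M (edge_labels r N M x) i j"
      using r by (intro sum_efron_stein edge_labels_PiE) auto
    finally have "(\<Sum>l\<in>{0..N}. \<Sum>T\<in>?Tl l. ?es M T) = F M (edge_labels r N M x) i j"
      by (simp add: Pow_def)
    moreover have "(\<Sum>l\<in>{0..N}. \<Sum>T\<in>?Tl l. ?es M T) = (\<Sum>T\<in>?Tl 0. ?es M T) + (\<Sum>l\<in>{1..N}. \<Sum>T\<in>?Tl l. ?es M T)"
      by (simp add: sum.atLeast_Suc_atMost)
    moreover have "?Tl 0 = {{}}" by (auto simp: finite_subset[of _ "{..<N}"])
    ultimately show ?thesis by (simp add: efron_stein_empty algebra_simps)
  qed
  have "(\<Sum>l\<in>{1..N}. \<Sum>K\<in>?S l. level_part r n t N F l K x i j) =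
     (\<Sum>l\<in>{1..N}. \<Sum>M\<in>?H. \<Sum>T\<in>?Tl l. ?es M T) / of_nat (card ?H)"
    unfolding lev by (rule sum_divide_distrib[symmetric])
  also have "(\<Sum>l\<in>{1..N}. \<Sum>M\<in>?H. \<Sum>T\<in>?Tl l. ?es M T) = (\<Sum>M\<in>?H. \<Sum>l\<in>{1..N}. \<Sum>T\<in>?Tl l. ?es M T)"
    by (rule sum.swap)
  finally show ?thesis unfolding all .
qed

section \<open>Contribution of a single level\<close>

lemma herm_sum:
  assumes "\<And>s. s \<in> S \<Longrightarrow> herm d (A s)"
  shows "herm d (\<lambda>i j. \<Sum>s\<in>S. A s i j)"
  unfolding herm_def cnj_sum
proof (intro allI impI sum.cong refl)
  fix i j s assume "i < d" "j < d" "s \<in> S"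
  then show "A s j i = cnj (A s i j)" by (simp add: hermD[OF assms])
qed

definition level_mean :: "nat \<Rightarrow> nat \<Rightarrow> nat \<Rightarrow> nat \<Rightarrow> nat \<Rightarrow> (nat set list \<Rightarrow> (nat \<Rightarrow> int) \<Rightarrow> nat \<Rightarrow> nat \<Rightarrow> complex) \<Rightarrow>
    ((nat \<Rightarrow> int) \<Rightarrow> nat \<Rightarrow> nat \<Rightarrow> complex) \<Rightarrow> nat \<Rightarrow> real" where
  "level_mean d r n t N F R l = (\<Sum>x\<in>PiE {..<n} (\<lambda>_. {0..<int r}).
     Re (mtr d (mmul d (\<lambda>i j. \<Sum>K\<in>{K. K \<subseteq> {..<n} \<and> card K = t * l}. level_part r n t N F l K x i j) (R x))))
       / card (PiE {..<n} (\<lambda>_. {0..<int r}))"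

lemma level_mean_power_le:
  assumes r: "r > 0" and tl: "t * l \<le> n" and ne: "hmatch n t N \<noteq> {}"
    and F: "\<And>M w. M \<in> hmatch n t N \<Longrightarrow> w \<in> PiE {..<N} (\<lambda>_. {0..<int r}) \<Longrightarrow> opbound d 1 (F M w)"
      "\<And>M w. M \<in> hmatch n t N \<Longrightarrow> w \<in> PiE {..<N} (\<lambda>_. {0..<int r}) \<Longrightarrow> herm d (F M w)"
    and R: "\<And>x. x \<in> PiE {..<n} (\<lambda>_. {0..<int r}) \<Longrightarrow> psd d (R x)"
      "\<And>x. x \<in> PiE {..<n} (\<lambda>_. {0..<int r}) \<Longrightarrow> mtr d (R x) = 1"
    and q: "q = 2 ^ Suc s"
  shows "level_mean d r n t N F R l ^ q \<le> real d * (2 ^ l * real (N choose l) / real (n choose (t * l))) ^ q *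
    real (card {\<kappa>. (set \<kappa> \<subseteq> {K. K \<subseteq> {..<n} \<and> card K = t * l} \<and> length \<kappa> = q) \<and> no_single \<kappa>})"
proof -
  let ?A = "{0..<int r}" and ?S = "{K. K \<subseteq> {..<n} \<and> card K = t * l}"
  let ?X = "PiE {..<n} (\<lambda>_. ?A)" and ?c = "2 ^ l * real (N choose l) / real (n choose (t * l))"
  let ?G = "\<lambda>x i j. \<Sum>K\<in>?S. level_part r n t N F l K x i j"
  let ?cd = "card {\<kappa>. (set \<kappa> \<subseteq> ?S \<and> length \<kappa> = q) \<and> no_single \<kappa>}"
  have finX: "finite ?X" by (rule finite_PiE_const) auto
  have X: "card ?X > 0" using r by (intro card_PiE_const_pos) auto
  then have neX: "?X \<noteq> {}" by fastforce
  have "level_mean d r n t N F R l ^ q \<le> (\<Sum>x\<in>?X. Re (mtr d (mprod d (replicate q (?G x))))) / card ?X"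
    unfolding level_mean_def q
    by (intro mean_trace_power_le finX neX R herm_sum level_part_herm r F)
  also have "\<dots> \<le> cmod (\<Sum>x\<in>?X. mtr d (mprod d (replicate q (?G x)))) / card ?X"
    unfolding Re_sum[symmetric] by (intro divide_right_mono complex_Re_le_cmod) auto
  also have "\<dots> \<le> ?cd * (card ?X * (real d * ?c ^ q)) / card ?X"
  proof (intro divide_right_mono moment_bound)
    fix K x assume "K \<in> ?S"
    then show "opbound d ?c (level_part r n t N F l K x)"
      using tl by (intro level_part_opbound r ne F) auto
  qed (use r in \<open>auto simp: level_part_indep intro!: level_part_mean_zero\<close>)
  also have "\<dots> = real d * ?c ^ q * ?cd" using X by (simp add: mult.commute mult.left_commute)
  finally show ?thesis .
qed

text \<open>A one-dimensional state is the scalar 1 and says nothing about x, so only the mean of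
  centred components remains. This settles m = 0, where the high levels would not be dominated by
  the low-level estimate.\<close>

lemma level_mean_dim_one:
  assumes r: "r > 0" and l: "t * l > 0"
    and R: "\<And>x. x \<in> PiE {..<n} (\<lambda>_. {0..<int r}) \<Longrightarrow> mtr 1 (R x) = 1"
  shows "level_mean 1 r n t N F R l = 0"
proof -
  let ?A = "{0..<int r}" and ?S = "{K. K \<subseteq> {..<n} \<and> card K = t * l}"
  let ?X = "PiE {..<n} (\<lambda>_. ?A)"
  let ?g = "\<lambda>K x. level_part r n t N F l K x 0 0"
  have zero: "(\<Sum>x\<in>?X. ?g K x) = 0" if K: "K \<in> ?S" for K
  proof -
    have "K \<noteq> {}" using K l by auto
    then obtain j where j: "j \<in> K" "j \<in> {..<n}" using K by blast
    have "of_nat (card ?A) * (\<Sum>x\<in>?X. ?g K x) = (\<Sum>x\<in>?X. \<Sum>a\<in>?A. ?g K (x(j := a)))"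
      by (rule sum_PiE_update[symmetric]) (use j in auto)
    also have "\<dots> = (\<Sum>x\<in>?X. 0)" by (intro sum.cong refl level_part_mean_zero r j)
    finally show ?thesis using r by simp
  qed
  have "(\<Sum>x\<in>?X. Re (mtr 1 (mmul 1 (\<lambda>i j. \<Sum>K\<in>?S. level_part r n t N F l K x i j) (R x)))) =
    (\<Sum>x\<in>?X. Re (\<Sum>K\<in>?S. ?g K x))"
    using R by (intro sum.cong refl) (simp add: mtr_def mmul_def)
  also have "\<dots> = Re (\<Sum>x\<in>?X. \<Sum>K\<in>?S. ?g K x)" by (rule Re_sum[symmetric])
  also have "(\<Sum>x\<in>?X. \<Sum>K\<in>?S. ?g K x) = (\<Sum>K\<in>?S. \<Sum>x\<in>?X. ?g K x)" by (rule sum.swap)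
  also have "\<dots> = (\<Sum>K\<in>?S. 0)" by (intro sum.cong refl zero)
  finally show ?thesis unfolding level_mean_def by simp
qed

text \<open>A lossy form of the duality between trace and operator norm: the moment inequality over
  a one-point set bounds the q-th power by d * c^q, and q is so large that d \<le> 2^q. The factor 2
  costs only an absolute constant.\<close>

lemma abs_tr_density_le:
  assumes H: "herm d H" "opbound d c H" and c: "0 \<le> c" and R: "psd d R" "mtr d R = 1" and d: "d \<le> 2 ^ m"
  shows "\<bar>Re (mtr d (mmul d H R))\<bar> \<le> 2 * c"
proof -
  define q :: nat where "q = 2 ^ Suc m"
  have "Re (mtr d (mmul d H R)) ^ q \<le> Re (mtr d (mprod d (replicate q H)))"
    using mean_trace_power_le[of "{()}" d "\<lambda>_. H" "\<lambda>_. R" m] H R unfolding q_def by simp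
  also have "\<dots> \<le> cmod (mtr d (mprod d (replicate q H)))" by (rule complex_Re_le_cmod)
  also have "\<dots> \<le> real d * c ^ q"
    using opbound_mprod[of "replicate q H" d c] H c by (intro cmod_mtr_le) auto
  also have "\<dots> \<le> 2 ^ q * c ^ q"
  proof (intro mult_right_mono)
    have "real d \<le> 2 ^ m" using d by (metis of_nat_le_iff of_nat_numeral of_nat_power)
    also have "\<dots> \<le> 2 ^ q" unfolding q_def by (intro power_increasing) (auto intro: less_imp_le order.trans[OF less_imp_le[OF less_exp]])
    finally show "real d \<le> 2 ^ q" .
  qed (use c in auto)
  finally have "\<bar>Re (mtr d (mmul d H R))\<bar> ^ q \<le> (2 * c) ^ q"
    unfolding power_mult_distrib q_def by (simp add: power_even_abs)
  then show ?thesis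
    using c power_le_imp_le_base[of _ "q - 1" "2 * c"] by (simp add: q_def)
qed

section \<open>Estimates for a single level\<close>

text \<open>Picking l points in each of t blocks of size L is one way to pick t * l points out of t
  * L; formally this is a single term of the Vandermonde sum.\<close>

lemma binomial_power_le: "(L choose l) ^ t \<le> (t * L choose (t * l))"
proof (induction t)
  case (Suc t)
  have "(L choose l) ^ Suc t \<le> (L choose l) * (t * L choose (t * l))" using Suc by simp
  also have "\<dots> = (\<lambda>k. (L choose k) * (t * L choose (Suc t * l - k))) l" by simp
  also have "\<dots> \<le> (\<Sum>k\<le>Suc t * l. (L choose k) * (t * L choose (Suc t * l - k)))"
    by (rule member_le_sum) auto
  also have "\<dots> = (Suc t * L choose (Suc t * l))" by (simp only: vandermonde mult_Suc)
  finally show ?case .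
qed simp

lemma Suc_times_binomial_Suc_real:
  assumes "l \<le> n"
  shows "real (Suc l) * real (n choose Suc l) = (real n - real l) * real (n choose l)"
proof -
  have "Suc l * (n choose Suc l) = (n - l) * (n choose l)" by (metis binomial_absorb_comp binomial_absorption)
  then have "real (Suc l) * real (n choose Suc l) = real (n - l) * real (n choose l)"
    by (simp only: of_nat_mult[symmetric])
  then show ?thesis using assms by (simp add: of_nat_diff)
qed

text \<open>The quotient of the binomials is the product of (N - i) / (L - i), and each factor is at
  most \<alpha> because \<alpha> \<le> 1.\<close>

lemma binomial_shrink:
  assumes N: "real N = \<alpha> * real L" and \<alpha>: "0 \<le> \<alpha>" "\<alpha> \<le> 1" and l: "l \<le> N"
  shows "real (N choose l) \<le> \<alpha> ^ l * real (L choose l)"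
  using l
proof (induction l)
  case (Suc l)
  have NL: "N \<le> L" using N \<alpha> mult_left_le_one_le[of "real L" \<alpha>] by (simp flip: of_nat_le_iff)
  have "real (Suc l) * real (N choose Suc l) = (real N - real l) * real (N choose l)"
    using Suc by (intro Suc_times_binomial_Suc_real) auto
  also have "\<dots> \<le> (\<alpha> * (real L - real l)) * (\<alpha> ^ l * real (L choose l))"
  proof (intro mult_mono)
    have "\<alpha> * real l \<le> 1 * real l" using \<alpha> by (intro mult_right_mono) auto
    then show "real N - real l \<le> \<alpha> * (real L - real l)" using N by (simp add: algebra_simps)
    show "0 \<le> \<alpha> * (real L - real l)" using \<alpha> Suc.prems NL by simp
  qed (use Suc in auto)
  also have "\<dots> = \<alpha> ^ Suc l * ((real L - real l) * real (L choose l))" by simp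
  also have "\<dots> = \<alpha> ^ Suc l * (real (Suc l) * real (L choose Suc l))"
    using Suc.prems NL by (subst Suc_times_binomial_Suc_real) auto
  finally have "real (Suc l) * real (N choose Suc l) \<le> real (Suc l) * (\<alpha> ^ Suc l * real (L choose Suc l))"
    by (simp only: mult.left_commute)
  then show ?case by (rule mult_left_le_imp_le) simp
qed simp

text \<open>The right-hand side is a falling factorial, all of whose factors are at least n /
  2.\<close>

lemma binomial_fact_ge:
  assumes "2 * k \<le> n"
  shows "(real n / 2) ^ k \<le> real (n choose k) * fact k"
  using assms
proof (induction k)
  case (Suc k)
  have "(real n / 2) ^ Suc k \<le> (real n - real k) * (real (n choose k) * fact k)"
    unfolding power_Suc using Suc by (intro mult_mono) auto
  also have "\<dots> = real (Suc k) * real (n choose Suc k) * fact k"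
    using Suc.prems by (subst Suc_times_binomial_Suc_real) auto
  finally show ?case by (simp only: fact_Suc mult_ac of_nat_mult of_nat_fact)
qed simp

text \<open>The base is chosen so that its half, 65/100, lies below the fourth power of 9/10, as the
  high levels require. From l = 8 on, consecutive squares grow by less than this ratio.\<close>

lemma square_le_exp: "real l ^ 2 \<le> 20 * (13/10) ^ l"
proof (induction l rule: nat_induct)
  case (Suc l)
  show ?case
  proof (cases "l \<ge> 8")
    case True
    have "real (Suc l) ^ 2 \<le> 13/10 * real l ^ 2"
    proof -
      have "8 * real l \<le> real l * real l" using True by (intro mult_right_mono) auto
      moreover have "real (Suc l) ^ 2 = real l * real l + 2 * real l + 1"
        by (simp add: power2_eq_square algebra_simps)
      moreover have "8 \<le> real l" using True by simp
      ultimately show ?thesis unfolding power2_eq_square[of "real l"] by linarith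
    qed
    then show ?thesis using Suc by simp
  next
    case False
    then have "l \<in> {0,1,2,3,4,5,6,7}" by auto
    then show ?thesis by (auto simp: power2_eq_square eval_nat_numeral)
  qed
qed simp

text \<open>One factor l / L is kept for the gain 1 / L; the remaining l - 1 factors are at most
  1/2.\<close>

lemma ratio_power_le:
  assumes "1 \<le> l" "2 * l \<le> L"
  shows "(real l / real L) ^ l \<le> (2 * real l / 2 ^ l) / real L"
proof -
  obtain k where k: "l = Suc k" using assms(1) by (cases l) auto
  have L: "real L > 0" using assms by simp
  have "(real l / real L) ^ k \<le> (1 / 2) ^ k"
    using assms L by (intro power_mono) (auto simp: field_simps)
  then have "real l / real L * (real l / real L) ^ k \<le> real l / real L * (1 / 2) ^ k"
    by (intro mult_left_mono) auto
  also have "\<dots> = (2 * real l / 2 ^ l) / real L"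
    using L by (simp add: k power_divide field_simps)
  finally show ?thesis using k by simp
qed

text \<open>Here 2^m \<le> 2^(l/2). The second moment leaves the power t - 2 of L choose l in the
  denominator, which supplies both the power of L inside D and an exponential decay in l that beats
  2^(l/2).\<close>

lemma large_level_bound:
  fixes B \<alpha> :: real
  assumes L: "real N = \<alpha> * real L" and \<alpha>: "0 < \<alpha>" "\<alpha> \<le> 1/2" and t: "3 \<le> t" and l: "1 \<le> l" "l \<le> N" "2 * m \<le> l"
    and B: "B ^ 2 \<le> 2 ^ m * (2 ^ l * real (N choose l) / real (t * L choose (t * l))) ^ 2 * real (t * L choose (t * l))"
    and D: "D \<ge> 0" "D ^ 2 = 4 * \<alpha>\<^sup>2 * real L ^ 2 / real L ^ t"
  shows "B \<le> 3 * D * (9/10) ^ l"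
proof -
  define b where "b = real (L choose l)"
  have NL: "2 * real N \<le> real L" using L \<alpha> mult_right_mono[of \<alpha> "1/2" "real L"] by simp
  then have l2: "2 * l \<le> L" using l by linarith
  then have lL: "l \<le> L" by simp
  have Lpos: "real L > 0" using l2 l by simp
  have bge: "(real L / real l) ^ l \<le> b" unfolding b_def by (rule binomial_ge_n_over_k_pow_k[OF lL])
  have bpos: "b > 0" unfolding b_def using lL by simp
  have cge: "b ^ t \<le> real (t * L choose (t * l))"
    unfolding b_def using binomial_power_le[of L l t] by (simp only: of_nat_power[symmetric] of_nat_le_iff)
  have cpos: "real (t * L choose (t * l)) > 0" using cge bpos by (meson less_le_trans zero_less_power)
  have t2: "2 + (t - 2) = t" using t by simp
  have bt: "b ^ t = b ^ 2 * b ^ (t - 2)" by (metis t2 power_add)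
  have sq: "u * (x / Q) ^ 2 * Q = u * x ^ 2 / Q" if "Q > 0" for u x Q :: real
    using that by (simp add: power_divide power2_eq_square)
  have Nb: "real (N choose l) \<le> \<alpha> ^ l * b" unfolding b_def using L \<alpha> l by (intro binomial_shrink) auto
  have "B ^ 2 \<le> 2 ^ m * (2 ^ l * real (N choose l)) ^ 2 / real (t * L choose (t * l))"
    using B unfolding sq[OF cpos] .
  also have "\<dots> \<le> 2 ^ m * (2 ^ l * (\<alpha> ^ l * b)) ^ 2 / b ^ t"
    using Nb cge bpos \<alpha> by (intro frac_le mult_left_mono power_mono) auto
  also have "\<dots> = 2 ^ m * ((2 * \<alpha>) ^ l) ^ 2 / b ^ (t - 2)"
    unfolding bt using bpos by (simp add: power_mult_distrib)
  also have "\<dots> \<le> 2 ^ m * (2 * \<alpha>) ^ 2 / b ^ (t - 2)"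
  proof -
    \<comment> \<open>One factor 2 * \<alpha> is enough to match D; the decay in l comes from
      \<open>b\<close>.\<close>
    have "(2 * \<alpha>) ^ l \<le> (2 * \<alpha>) ^ 1" using \<alpha> l by (intro power_decreasing) auto
    then show ?thesis using \<alpha> bpos by (intro divide_right_mono mult_left_mono power_mono) auto
  qed
  finally have B2: "B ^ 2 \<le> 2 ^ m * (2 * \<alpha>) ^ 2 / b ^ (t - 2)" .
  have inv: "1 / b \<le> (2 * real l / 2 ^ l) / real L"
  proof -
    have "1 / b \<le> 1 / (real L / real l) ^ l" using bge bpos l Lpos by (intro divide_left_mono mult_pos_pos zero_less_power divide_pos_pos) auto
    also have "\<dots> = (real l / real L) ^ l" by (simp add: power_divide)
    also have "\<dots> \<le> (2 * real l / 2 ^ l) / real L" by (rule ratio_power_le[OF l(1) l2])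
    finally show ?thesis .
  qed
  \<comment> \<open>What 1 / b gains beyond 1 / L.\<close>
  define z where "z = 2 * real l / 2 ^ l"
  have z: "0 \<le> z" "z \<le> 1"
  proof -
    obtain k where k: "l = Suc k" using l(1) by (cases l) auto
    have "Suc k \<le> 2 ^ k" by (induction k) auto
    then have "real (Suc k) \<le> 2 ^ k" by (metis of_nat_le_iff of_nat_numeral of_nat_power)
    then show "z \<le> 1" unfolding z_def k by (simp add: field_simps)
  qed (simp add: z_def)
  have "(1 / b) ^ (t - 2) \<le> (z / real L) ^ (t - 2)"
    using inv bpos unfolding z_def by (intro power_mono) auto
  also have "\<dots> \<le> z * (1 / real L) ^ (t - 2)"
  proof -
    \<comment> \<open>A single factor z survives for every t, and t \<ge> 3 guarantees it.\<close>
    have "z ^ (t - 2) \<le> z ^ 1" using z t by (intro power_decreasing) auto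
    then show ?thesis using mult_right_mono[of "z ^ (t - 2)" z "(1 / real L) ^ (t - 2)"]
      by (simp add: power_divide)
  qed
  also have "(1 / real L) ^ (t - 2) = real L ^ 2 / real L ^ t"
  proof -
    have "real L ^ t = real L ^ 2 * real L ^ (t - 2)" by (metis t2 power_add)
    then show ?thesis using Lpos by (simp add: power_divide)
  qed
  finally have ib: "1 / b ^ (t - 2) \<le> z * (real L ^ 2 / real L ^ t)" by (simp add: power_divide)
  have "B ^ 2 \<le> 2 ^ m * (2 * \<alpha>) ^ 2 * (1 / b ^ (t - 2))" using B2 by simp
  also have "\<dots> \<le> 2 ^ m * (2 * \<alpha>) ^ 2 * (z * (real L ^ 2 / real L ^ t))"
    using ib by (intro mult_left_mono) auto
  also have "\<dots> = 2 ^ m * z * D ^ 2" unfolding D(2) by (simp add: power2_eq_square)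
  finally have B2': "B ^ 2 \<le> 2 ^ m * z * D ^ 2" .
  \<comment> \<open>Squaring lets 2 * m \<le> l enter as 2^(2 * m) \<le> 2^l, without halving an
    exponent.\<close>
  have "(2 ^ m * z) ^ 2 \<le> 81 * ((9/10) ^ 4) ^ l"
  proof -
    have "(2 ^ m * z) ^ 2 = (2 :: real) ^ (2 * m) * z ^ 2" by (simp add: power_mult_distrib power_mult mult.commute)
    also have "\<dots> \<le> 2 ^ l * z ^ 2" using l by (intro mult_right_mono power_increasing) auto
    also have "\<dots> = 4 * real l ^ 2 * (1/2) ^ l"
      unfolding z_def by (simp add: power_divide power2_eq_square field_simps)
    also have "\<dots> \<le> 4 * (20 * (13/10) ^ l) * (1/2) ^ l"
      using square_le_exp[of l] by (intro mult_right_mono mult_left_mono) auto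
    also have "\<dots> = 80 * (65/100) ^ l" by (simp flip: power_mult_distrib)
    \<comment> \<open>Rounded up to fourth powers of 3 and 9/10, since two more square roots are
      taken to reach B.\<close>
    also have "\<dots> \<le> 81 * ((9/10) ^ 4) ^ l"
      by (intro mult_mono power_mono) (auto simp: power4_eq_xxxx)
    finally show ?thesis .
  qed
  also have "\<dots> = ((3 * (9/10) ^ l) ^ 2) ^ 2"
    by (simp flip: power_mult add: power_mult_distrib mult.commute)
  finally have "2 ^ m * z \<le> (3 * (9/10) ^ l) ^ 2" by (rule power2_le_imp_le) simp
  then have "B ^ 2 \<le> (3 * (9/10) ^ l) ^ 2 * D ^ 2"
    using B2' mult_right_mono[of "2 ^ m * z" "(3 * (9/10) ^ l) ^ 2" "D ^ 2"] by simp
  also have "\<dots> = (3 * D * (9/10) ^ l) ^ 2" by (simp add: power2_eq_square)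
  finally show ?thesis by (rule power2_le_imp_le) (use D(1) in simp)
qed

text \<open>The least power of two for which q = 2 * 2^s satisfies m \<le> q * l; minimality gives
  the upper bound, and the assumption on l covers s = 0.\<close>

lemma obtain_power_of_two:
  fixes l m :: nat
  assumes "1 \<le> l" "l \<le> 2 * m"
  obtains s :: nat where "m \<le> 2 * 2 ^ s * l" "2 ^ s * l \<le> 2 * m"
proof -
  define s where "s = (LEAST s :: nat. m \<le> 2 * 2 ^ s * l)"
  have "m \<le> 2 ^ m" using less_exp[of m] by simp
  also have "\<dots> \<le> 2 * 2 ^ m * l" using assms(1) by simp
  finally have s: "m \<le> 2 * 2 ^ s * l" unfolding s_def by (rule LeastI)
  have "2 ^ s * l \<le> 2 * m"
  proof (cases s)
    case (Suc s')
    then have "\<not> m \<le> 2 * 2 ^ s' * l" unfolding s_def using not_less_Least[of s'] by (metis lessI)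
    then show ?thesis using Suc by simp
  qed (use assms in simp)
  then show ?thesis using s that by blast
qed

text \<open>With m \<le> 2 * p * l the dimension is absorbed as 2^m \<le> (2^l)^(2 * p), and a p-th
  root can be taken. The upper bound on p * l then replaces all remaining occurrences of p and l by
  m, leaving an l-th power.\<close>

lemma small_level_bound:
  fixes B \<alpha> :: real
  assumes L: "real N = \<alpha> * real L" and \<alpha>: "0 < \<alpha>" "\<alpha> \<le> 1/2" and t: "3 \<le> t" and l: "1 \<le> l" "l \<le> N" "l \<le> 2 * m"
    and p: "m \<le> 2 * p * l" "p * l \<le> 2 * m" "1 \<le> p"
    and B: "B ^ (2 * p) \<le> 2 ^ m * (2 ^ l * real (N choose l) / real (t * L choose (t * l))) ^ (2 * p) *
       ((exp 1 * real (t * L) * real (t * l * p)) ^ (t * l * p) / fact (t * l) ^ (2 * p))"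
    and Y: "Y = (4 * exp 1 * \<alpha>)\<^sup>2 * real L ^ 2 * (8 * exp 1 * real m / real L) ^ t"
  shows "B ^ 2 \<le> Y ^ l"
proof -
  define k n where "k = t * l" and "n = t * L"
  \<comment> \<open>The falling factorial n (n - 1) ... (n - k + 1), formed from the norm bound and
    the tuple count.\<close>
  define C where "C = real (n choose k) * fact k"
  have NL: "2 * real N \<le> real L" using L \<alpha> mult_right_mono[of \<alpha> "1/2" "real L"] by simp
  then have l2: "2 * l \<le> L" using l by linarith
  have Lpos: "real L > 0" using l2 l by simp
  have npos: "real n > 0" unfolding n_def using Lpos t by simp
  have C: "(real n / 2) ^ k \<le> C" unfolding C_def
    by (rule binomial_fact_ge) (use l2 in \<open>simp add: k_def n_def\<close>)
  have Cpos: "C > 0" using C npos by (meson less_le_trans zero_less_power half_gt_zero)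
  define Z where "Z = (4 ^ l * real (N choose l) / C) ^ 2 * (exp 1 * real n * real (k * p)) ^ k"
  have Z0: "Z \<ge> 0" unfolding Z_def using Cpos by simp
  have "(B ^ 2) ^ p = B ^ (2 * p)" by (simp add: power_mult)
  also have "\<dots> \<le> 2 ^ m * (2 ^ l * real (N choose l) / C) ^ (2 * p) * (exp 1 * real n * real (k * p)) ^ (k * p)"
    using B unfolding C_def k_def[symmetric] n_def[symmetric] by (simp add: power_divide power_mult_distrib)
  also have "\<dots> \<le> 2 ^ (2 * p * l) * (2 ^ l * real (N choose l) / C) ^ (2 * p) * (exp 1 * real n * real (k * p)) ^ (k * p)"
    using p Cpos by (intro mult_right_mono power_increasing) auto
  also have "\<dots> = Z ^ p"
  proof -
    have "(2::real) ^ (2 * p * l) = (2 ^ l) ^ (2 * p)" by (metis mult.commute power_mult)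
    then have "(2::real) ^ (2 * p * l) * (2 ^ l * real (N choose l) / C) ^ (2 * p) =
       (2 ^ l * (2 ^ l * real (N choose l) / C)) ^ (2 * p)"
      by (simp only: power_mult_distrib)
    also have "2 ^ l * (2 ^ l * real (N choose l) / C) = 4 ^ l * real (N choose l) / C"
      using power_mult_distrib[of "2::real" 2 l] by simp
    finally show ?thesis unfolding Z_def power_mult_distrib power_mult[symmetric] by simp
  qed
  finally have BZ: "B ^ 2 \<le> Z"
    using Z0 p(3) power_le_imp_le_base[of "B ^ 2" "p - 1" Z] by simp
  have "real (N choose l) \<le> real N ^ l / fact l" by (rule binomial_le_pow_fact)
  also have "\<dots> \<le> real N ^ l * (exp (real l) / real l ^ l)"
  proof -
    have "1 / fact l \<le> exp (real l) / real l ^ l"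
      using power_self_le_exp_fact[of l] l by (simp add: field_simps)
    from mult_left_mono[OF this, of "real N ^ l"] show ?thesis by simp
  qed
  also have "\<dots> = (exp 1 * real N / real l) ^ l"
    by (simp add: power_mult_distrib power_divide exp_of_nat_mult[symmetric])
  \<comment> \<open>The factor l^l in the denominator is given away.\<close>
  also have "\<dots> \<le> (exp 1 * real N) ^ l"
    using l by (intro power_mono) (auto simp: field_simps)
  finally have Nl: "real (N choose l) \<le> (exp 1 * real N) ^ l" .
  have "Z \<le> (4 ^ l * (exp 1 * real N) ^ l / (real n / 2) ^ k) ^ 2 * (exp 1 * real n * real (k * p)) ^ k"
    unfolding Z_def using Nl C Cpos npos
    by (intro mult_right_mono power_mono frac_le mult_left_mono) auto
  also have "\<dots> = ((4 * exp 1 * real N) ^ 2) ^ l * (4 * exp 1 * real (k * p) / real n) ^ k"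
  proof -
    have 1: "4 ^ l * (exp 1 * real N) ^ l = (4 * exp 1 * real N) ^ l"
      by (simp add: power_mult_distrib)
    have 2: "(u ^ l / v ^ k) ^ 2 * w ^ k = (u ^ 2) ^ l * (w / v ^ 2) ^ k" for u v w :: real
      by (simp add: power_divide power_mult[symmetric] mult.commute)
    have 3: "exp 1 * real n * real (k * p) / (real n / 2) ^ 2 = 4 * exp 1 * real (k * p) / real n"
      using npos by (simp add: power2_eq_square)
    show ?thesis unfolding 1 2 3 ..
  qed
  also have "\<dots> \<le> ((4 * exp 1 * real N) ^ 2) ^ l * (8 * exp 1 * real m / real L) ^ k"
  proof -
    have "real (p * l) \<le> real (2 * m)" using p by (simp only: of_nat_le_iff)
    then have "real l * real p / real L \<le> 2 * real m / real L" using Lpos by (simp add: divide_right_mono mult.commute)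
    moreover have "real (k * p) / real n = real l * real p / real L"
      using t Lpos by (simp add: k_def n_def)
    ultimately have "4 * exp 1 * (real (k * p) / real n) \<le> 4 * exp 1 * (2 * real m / real L)"
      by (intro mult_left_mono) auto
    then have "4 * exp 1 * real (k * p) / real n \<le> 8 * exp 1 * real m / real L" by simp
    then show ?thesis by (intro mult_left_mono power_mono) auto
  qed
  also have "\<dots> = Y ^ l"
    unfolding Y L k_def by (simp add: power_mult_distrib power_mult)
  finally show ?thesis using BZ by simp
qed

section \<open>Summing over the levels\<close>

lemma sum_geometric_le:
  fixes x :: real
  assumes "0 \<le> x" "x < 1"
  shows "(\<Sum>l\<in>{1..N}. x ^ (l - 1)) \<le> 1 / (1 - x)"
proof -
  have "(\<Sum>l\<in>{1..N}. x ^ (l - 1)) = (\<Sum>l\<in>{..<N}. x ^ l)"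
    by (rule sum.reindex_bij_witness[of _ Suc "\<lambda>l. l - 1"]) auto
  also have "\<dots> \<le> (\<Sum>l. x ^ l)"
    using assms by (intro sum_le_suminf summable_geometric) auto
  also have "\<dots> = 1 / (1 - x)" using assms by (intro suminf_geometric) auto
  finally show ?thesis .
qed

lemma exp_1_ge_2: "(2::real) \<le> exp 1"
  using exp_ge_add_one_self[of 1] by simp

text \<open>The root y of Y bounds the first low level, and low level l is at most y^l. High levels
  start from D, smaller than y by a constant factor, and decay at the slower rate 9/10; the total
  stays of order y.\<close>

lemma sum_level_mean_le:
  assumes r: "r > 0" and m: "1 \<le> m" and d: "d = 2 ^ m"
    and L: "real N = \<alpha> * real L" and Lpos: "L > 0" and \<alpha>: "0 < \<alpha>" "\<alpha> \<le> 1/2" and t: "3 \<le> t" and n: "n = t * L"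
    and ne: "hmatch n t N \<noteq> {}"
    and F: "\<And>M w. M \<in> hmatch n t N \<Longrightarrow> w \<in> PiE {..<N} (\<lambda>_. {0..<int r}) \<Longrightarrow> opbound d 1 (F M w)"
      "\<And>M w. M \<in> hmatch n t N \<Longrightarrow> w \<in> PiE {..<N} (\<lambda>_. {0..<int r}) \<Longrightarrow> herm d (F M w)"
    and R: "\<And>x. x \<in> PiE {..<n} (\<lambda>_. {0..<int r}) \<Longrightarrow> psd d (R x)"
      "\<And>x. x \<in> PiE {..<n} (\<lambda>_. {0..<int r}) \<Longrightarrow> mtr d (R x) = 1"
    and Y: "Y = (4 * exp 1 * \<alpha>)\<^sup>2 * real L ^ 2 * (8 * exp 1 * real m / real L) ^ t" "Y \<le> 1/4"
  shows "(\<Sum>l\<in>{1..N}. level_mean d r n t N F R l) \<le> 3 * sqrt Y"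
proof -
  define y where "y = sqrt Y"
  define D where "D = sqrt (4 * \<alpha>\<^sup>2 * real L ^ 2 / real L ^ t)"
  have Y0: "0 \<le> Y" unfolding Y by simp
  have y: "0 \<le> y" "y ^ 2 = Y" "y \<le> 1/2"
  proof -
    show "0 \<le> y" "y ^ 2 = Y" using Y0 by (auto simp: y_def)
    have "sqrt Y \<le> sqrt ((1/2) ^ 2)" using Y(2) by (intro real_sqrt_le_mono) (simp add: power2_eq_square)
    then show "y \<le> 1/2" unfolding y_def by simp
  qed
  have D: "0 \<le> D" "D ^ 2 = 4 * \<alpha>\<^sup>2 * real L ^ 2 / real L ^ t" by (auto simp: D_def)
  have Dy: "D \<le> y / 100"
  proof -
    \<comment> \<open>Both m \<ge> 1 and t \<ge> 3 enter here: Y / D^2 = 4 * e^2 * (8 * e * m)^t is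
      at least 16 * 16^3, more than 100^2.\<close>
    have "(16 :: real) ^ 3 \<le> 16 ^ t" using t by (intro power_increasing) auto
    also have "\<dots> \<le> (8 * exp 1 * real m) ^ t"
    proof (intro power_mono)
      have "8 * 2 * 1 \<le> 8 * exp 1 * real m" using exp_1_ge_2 m by (intro mult_mono) auto
      then show "16 \<le> 8 * exp 1 * real m" by simp
    qed auto
    finally have 1: "4096 \<le> (8 * exp 1 * real m) ^ t" by simp
    have "(2::real) * 2 \<le> exp 1 * exp 1" using exp_1_ge_2 by (intro mult_mono) auto
    then have 2: "(4::real) \<le> (exp 1) ^ 2" by (simp add: power2_eq_square)
    have "100 ^ 2 * D ^ 2 \<le> 16 * 4 * \<alpha>\<^sup>2 * real L ^ 2 / real L ^ t * 4096"
      unfolding D(2) using \<alpha> Lpos by (simp add: field_simps)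
    also have "\<dots> \<le> 16 * (exp 1) ^ 2 * \<alpha>\<^sup>2 * real L ^ 2 / real L ^ t * (8 * exp 1 * real m) ^ t"
      using 1 2 by (intro mult_mono divide_right_mono mult_right_mono mult_left_mono) auto
    also have "\<dots> = y ^ 2" unfolding y(2) Y(1) by (simp add: power_divide power_mult_distrib)
    finally have "(100 * D) ^ 2 \<le> y ^ 2" by (simp add: power_mult_distrib)
    then have "100 * D \<le> y" using y(1) by (rule power2_le_imp_le)
    then show ?thesis by simp
  qed
  have NL: "2 * real N \<le> real L" using L \<alpha> mult_right_mono[of \<alpha> "1/2" "real L"] by simp
  have level: "level_mean d r n t N F R l \<le> y * (1/2) ^ (l - 1) + y / 30 * (9/10) ^ (l - 1)" if l: "l \<in> {1..N}" for l
  proof -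
    have tl: "t * l \<le> n" unfolding n using l NL by (intro mult_le_mono) auto
    let ?B = "level_mean d r n t N F R l"
    let ?cd = "\<lambda>q. real (card {\<kappa>. (set \<kappa> \<subseteq> {K. K \<subseteq> {..<n} \<and> card K = t * l} \<and> length \<kappa> = q) \<and> no_single \<kappa>})"
    let ?c = "2 ^ l * real (N choose l) / real (n choose (t * l))"
    have pow: "?B ^ q \<le> 2 ^ m * ?c ^ q * ?cd q" if "q = 2 ^ Suc s" for q s
      using level_mean_power_le[OF r tl ne F R that] unfolding d by simp
    show ?thesis
    proof (cases "2 * m \<le> l")
      case True
      have "?B ^ 2 \<le> 2 ^ m * ?c ^ 2 * ?cd 2" using pow[of 2 0] by simp
      also have "\<dots> \<le> 2 ^ m * ?c ^ 2 * real (n choose (t * l))"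
        using card_no_single_two[of "{..<n}" "t * l"] by (intro mult_left_mono) auto
      finally have "?B \<le> 3 * D * (9/10) ^ l"
        unfolding n using l True by (intro large_level_bound[OF L \<alpha> t _ _ _ _ D]) auto
      also have "\<dots> \<le> 3 * (y / 100) * (9/10) ^ (l - 1)"
        using Dy D(1) y by (intro mult_mono power_decreasing) auto
      also have "\<dots> \<le> y / 30 * (9/10) ^ (l - 1)" using y(1) by (intro mult_right_mono) auto
      finally show ?thesis using y(1) by (simp add: add_increasing)
    next
      case False
      obtain s where s: "m \<le> 2 * 2 ^ s * l" "2 ^ s * l \<le> 2 * m"
        using obtain_power_of_two[of l m] l False by auto
      define p :: nat where "p = 2 ^ s"
      have "?B ^ (2 * p) \<le> 2 ^ m * ?c ^ (2 * p) * ?cd (2 * p)" using pow[of "2 * p" s] by (simp add: p_def)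
      also have "\<dots> \<le> 2 ^ m * ?c ^ (2 * p) * ((exp 1 * real n * real (t * l * p)) ^ (t * l * p) / fact (t * l) ^ (2 * p))"
        using card_no_single_le[of "{..<n}" n "t * l * p" "t * l" p] by (intro mult_left_mono) auto
      finally have "?B ^ 2 \<le> Y ^ l"
        unfolding n using l False s by (intro small_level_bound[OF L \<alpha> t _ _ _ _ _ _ _ Y(1), where p = p]) (auto simp: p_def)
      also have "\<dots> = (y ^ l) ^ 2" unfolding y(2)[symmetric] by (simp add: power_mult[symmetric] mult.commute)
      finally have "?B \<le> y ^ l" by (rule power2_le_imp_le) (use y in simp)
      also have "\<dots> = y * y ^ (l - 1)" using l by (cases l) auto
      also have "\<dots> \<le> y * (1/2) ^ (l - 1)" using y by (intro mult_left_mono power_mono) auto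
      finally show ?thesis using y(1) by (simp add: add_increasing2)
    qed
  qed
  have "(\<Sum>l\<in>{1..N}. level_mean d r n t N F R l) \<le> (\<Sum>l\<in>{1..N}. y * (1/2) ^ (l - 1) + y / 30 * (9/10) ^ (l - 1))"
    by (intro sum_mono level)
  also have "\<dots> = y * (\<Sum>l\<in>{1..N}. (1/2) ^ (l - 1)) + y / 30 * (\<Sum>l\<in>{1..N}. (9/10) ^ (l - 1))"
    by (simp only: sum.distrib sum_distrib_left)
  \<comment> \<open>The geometric sums 2 and 10 give 2 * y + y / 3 in total.\<close>
  also have "\<dots> \<le> y * (1 / (1 - 1/2)) + y / 30 * (1 / (1 - 9/10))"
    using y by (intro add_mono mult_left_mono sum_geometric_le) auto
  also have "\<dots> \<le> 3 * y" using y by simp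
  finally show ?thesis by (simp add: y_def)
qed

section \<open>The advantage as a gap between traces\<close>

definition trace_prod :: "nat \<Rightarrow> (nat \<Rightarrow> nat \<Rightarrow> complex) \<Rightarrow> (nat \<Rightarrow> nat \<Rightarrow> complex) \<Rightarrow> real" where
  "trace_prod d A R = Re (mtr d (mmul d A R))"

lemma trace_prod_sum: "trace_prod d (\<lambda>i j. \<Sum>s\<in>S. A s i j) R = (\<Sum>s\<in>S. trace_prod d (A s) R)"
proof -
  have "mtr d (mmul d (\<lambda>i j. \<Sum>s\<in>S. A s i j) R) = (\<Sum>i<d. \<Sum>k<d. \<Sum>s\<in>S. A s i k * R k i)"
    by (simp add: mtr_def mmul_def sum_distrib_right)
  also have "\<dots> = (\<Sum>i<d. \<Sum>s\<in>S. \<Sum>k<d. A s i k * R k i)" by (intro sum.cong refl sum.swap)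
  also have "\<dots> = (\<Sum>s\<in>S. mtr d (mmul d (A s) R))" unfolding mtr_def mmul_def by (rule sum.swap)
  finally show ?thesis by (simp add: trace_prod_def)
qed

lemma trace_prod_diff: "trace_prod d (\<lambda>i j. A i j - B i j) R = trace_prod d A R - trace_prod d B R"
  by (simp add: trace_prod_def mtr_def mmul_def left_diff_distrib sum_subtractf)

lemma trace_prod_divide: "trace_prod d (\<lambda>i j. A i j / of_nat c) R = trace_prod d A R / real c"
proof -
  have "mtr d (mmul d (\<lambda>i j. A i j / of_nat c) R) = mtr d (mmul d A R) / of_nat c"
    by (simp add: mtr_def mmul_def sum_divide_distrib)
  then show ?thesis by (simp add: trace_prod_def Re_divide_of_nat)
qed

text \<open>Twice the advantage, see \<open>success_prob_eq_label_gap\<close>.\<close>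

definition label_gap :: "nat \<Rightarrow> nat \<Rightarrow> nat \<Rightarrow> nat \<Rightarrow> nat \<Rightarrow> (nat set list \<Rightarrow> (nat \<Rightarrow> int) \<Rightarrow> nat \<Rightarrow> nat \<Rightarrow> complex) \<Rightarrow>
    ((nat \<Rightarrow> int) \<Rightarrow> nat \<Rightarrow> nat \<Rightarrow> complex) \<Rightarrow> real" where
  "label_gap d r n t N F R = (\<Sum>x\<in>PiE {..<n} (\<lambda>_. {0..<int r}).
     (\<Sum>M\<in>hmatch n t N. trace_prod d (F M (edge_labels r N M x)) (R x) -
        (\<Sum>w\<in>PiE {..<N} (\<lambda>_. {0..<int r}). trace_prod d (F M w) (R x)) / card (PiE {..<N} (\<lambda>_. {0..<int r})))
       / card (hmatch n t N)) / card (PiE {..<n} (\<lambda>_. {0..<int r}))"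

lemma label_gap_eq_sum_level_mean:
  assumes r: "r > 0"
  shows "label_gap d r n t N F R = (\<Sum>l\<in>{1..N}. level_mean d r n t N F R l)"
proof -
  let ?A = "{0..<int r}"
  let ?X = "PiE {..<n} (\<lambda>_. ?A)" and ?W = "PiE {..<N} (\<lambda>_. ?A)" and ?H = "hmatch n t N"
  let ?G = "\<lambda>l x i j. \<Sum>K\<in>{K. K \<subseteq> {..<n} \<and> card K = t * l}. level_part r n t N F l K x i j"
  have "(\<Sum>l\<in>{1..N}. level_mean d r n t N F R l) = (\<Sum>l\<in>{1..N}. \<Sum>x\<in>?X. trace_prod d (?G l x) (R x)) / card ?X"
    unfolding level_mean_def trace_prod_def by (rule sum_divide_distrib[symmetric])
  also have "(\<Sum>l\<in>{1..N}. \<Sum>x\<in>?X. trace_prod d (?G l x) (R x)) = (\<Sum>x\<in>?X. \<Sum>l\<in>{1..N}. trace_prod d (?G l x) (R x))"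
    by (rule sum.swap)
  also have "\<dots> = (\<Sum>x\<in>?X. trace_prod d (\<lambda>i j. \<Sum>l\<in>{1..N}. ?G l x i j) (R x))" by (simp only: trace_prod_sum)
  also have "\<dots> = (\<Sum>x\<in>?X. (\<Sum>M\<in>?H. trace_prod d (F M (edge_labels r N M x)) (R x) -
        (\<Sum>w\<in>?W. trace_prod d (F M w) (R x)) / card ?W) / card ?H)"
    unfolding sum_level_part[OF r] by (simp only: trace_prod_sum trace_prod_diff trace_prod_divide)
  finally show ?thesis unfolding label_gap_def by simp
qed

lemma label_gap_le_4:
  assumes r: "r > 0" and ne: "hmatch n t N \<noteq> {}"
    and b: "\<And>M w x. M \<in> hmatch n t N \<Longrightarrow> w \<in> PiE {..<N} (\<lambda>_. {0..<int r}) \<Longrightarrow>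
       x \<in> PiE {..<n} (\<lambda>_. {0..<int r}) \<Longrightarrow> \<bar>trace_prod d (F M w) (R x)\<bar> \<le> 2"
  shows "label_gap d r n t N F R \<le> 4"
proof -
  let ?A = "{0..<int r}"
  let ?X = "PiE {..<n} (\<lambda>_. ?A)" and ?W = "PiE {..<N} (\<lambda>_. ?A)" and ?H = "hmatch n t N"
  have mean: "(\<Sum>s\<in>S. f s) / card S \<le> c" if "card S > 0" "\<And>s. s \<in> S \<Longrightarrow> f s \<le> c" for S :: "'z set" and f and c :: real
    using that sum_bounded_above[of S f c] by (simp add: field_simps)
  have "card ?X > 0" "card ?W > 0" using r by (intro card_PiE_const_pos; simp)+
  moreover have "card ?H > 0" using ne finite_hmatch by (simp add: card_gt_0_iff)
  moreover have "trace_prod d (F M (edge_labels r N M x)) (R x) - (\<Sum>w\<in>?W. trace_prod d (F M w) (R x)) / card ?W \<le> 4"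
    if "M \<in> ?H" "x \<in> ?X" for M x
  proof -
    have "(\<Sum>w\<in>?W. - trace_prod d (F M w) (R x)) / card ?W \<le> 2"
    proof (rule mean)
      fix w assume "w \<in> ?W"
      then show "- trace_prod d (F M w) (R x) \<le> 2" using b[of M w x] that by simp
    qed fact
    moreover have "trace_prod d (F M (edge_labels r N M x)) (R x) \<le> 2"
      using b[OF that(1) edge_labels_PiE[OF r] that(2)] by (simp add: abs_le_iff)
    ultimately show ?thesis by (simp add: sum_negf)
  qed
  ultimately show ?thesis unfolding label_gap_def by (intro mean) auto
qed

lemma label_gap_square_le:
  assumes r: "r > 0" and d: "d = 2 ^ m"
    and L: "real N = \<alpha> * real L" and Lpos: "L > 0" and \<alpha>: "0 < \<alpha>" "\<alpha> \<le> 1/2" and t: "3 \<le> t" and n: "n = t * L"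
    and ne: "hmatch n t N \<noteq> {}"
    and F: "\<And>M w. M \<in> hmatch n t N \<Longrightarrow> w \<in> PiE {..<N} (\<lambda>_. {0..<int r}) \<Longrightarrow> opbound d 1 (F M w)"
      "\<And>M w. M \<in> hmatch n t N \<Longrightarrow> w \<in> PiE {..<N} (\<lambda>_. {0..<int r}) \<Longrightarrow> herm d (F M w)"
    and R: "\<And>x. x \<in> PiE {..<n} (\<lambda>_. {0..<int r}) \<Longrightarrow> psd d (R x)"
      "\<And>x. x \<in> PiE {..<n} (\<lambda>_. {0..<int r}) \<Longrightarrow> mtr d (R x) = 1"
    and \<epsilon>: "0 < \<epsilon>" "2 * \<epsilon> \<le> label_gap d r n t N F R"
  shows "\<epsilon> \<le> 2" "\<epsilon>\<^sup>2 \<le> 16 * ((4 * exp 1 * \<alpha>)\<^sup>2 * real L ^ 2 * (8 * exp 1 * real m / real L) ^ t)"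
proof -
  define Y where "Y = (4 * exp 1 * \<alpha>)\<^sup>2 * real L ^ 2 * (8 * exp 1 * real m / real L) ^ t"
  have "label_gap d r n t N F R \<le> 4"
  proof (rule label_gap_le_4[OF r ne])
    fix M w x assume "M \<in> hmatch n t N" "w \<in> PiE {..<N} (\<lambda>_. {0..<int r})" "x \<in> PiE {..<n} (\<lambda>_. {0..<int r})"
    then show "\<bar>trace_prod d (F M w) (R x)\<bar> \<le> 2"
      unfolding trace_prod_def using abs_tr_density_le[of d "F M w" 1 "R x" m] F R d by simp
  qed
  then show \<epsilon>2: "\<epsilon> \<le> 2" using \<epsilon> by simp
  have m: "1 \<le> m"
  proof (rule ccontr)
    assume "\<not> 1 \<le> m"
    then have d1: "d = 1" using d by simp
    have "label_gap d r n t N F R = (\<Sum>l\<in>{1..N}. 0)"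
      unfolding label_gap_eq_sum_level_mean[OF r]
    proof (rule sum.cong[OF refl])
      fix l assume "l \<in> {1..N}"
      then have "t * l > 0" using t by simp
      from level_mean_dim_one[OF r this] show "level_mean d r n t N F R l = 0"
        using R(2) unfolding d1 by blast
    qed
    then show False using \<epsilon> by simp
  qed
  have Y0: "0 \<le> Y" unfolding Y_def by simp
  have "\<epsilon>\<^sup>2 \<le> 16 * Y"
  proof (cases "Y \<le> 1/4")
    case True
    have "(\<Sum>l\<in>{1..N}. level_mean d r n t N F R l) \<le> 3 * sqrt Y"
      by (rule sum_level_mean_le[OF r m d L Lpos \<alpha> t n ne F R Y_def True])
    then have "2 * \<epsilon> \<le> 3 * sqrt Y"
      using \<epsilon>(2) unfolding label_gap_eq_sum_level_mean[OF r] by simp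
    then have "(2 * \<epsilon>) ^ 2 \<le> (3 * sqrt Y) ^ 2" using \<epsilon>(1) by (intro power_mono) auto
    then show ?thesis using Y0 by (simp add: power_mult_distrib)
  next
    case False
    have "\<epsilon>\<^sup>2 \<le> 2 ^ 2" using \<epsilon>2 \<epsilon>(1) by (intro power_mono) auto
    then show ?thesis using False by simp
  qed
  then show "\<epsilon>\<^sup>2 \<le> 16 * ((4 * exp 1 * \<alpha>)\<^sup>2 * real L ^ 2 * (8 * exp 1 * real m / real L) ^ t)"
    by (simp add: Y_def)
qed

section \<open>Solving for the number of qubits\<close>

lemma qubits_lower_bound:
  fixes \<alpha> \<epsilon> :: real
  assumes "0 < \<alpha>" "0 < \<epsilon>" "\<epsilon> \<le> 2" "L > 0" "3 \<le> t" "2 \<le> r"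
    and b: "\<epsilon>\<^sup>2 \<le> 16 * ((4 * exp 1 * \<alpha>)\<^sup>2 * real L ^ 2 * (8 * exp 1 * real m / real L) ^ t)"
  shows "1 / (8 * exp 1 * (1024 * (exp 1)\<^sup>2)) *
    (real r powr (- (1 + 1 / real t)) * (\<epsilon>\<^sup>2 / \<alpha>) powr (2 / real t) * real L powr (1 - 2 / real t)) \<le> real m"
proof -
  define e :: real where "e = exp 1"
  \<comment> \<open>1024 * e^2 = 4 * 16 * (4 * e)^2, where 4 comes from lowering a power of
    \<epsilon> and the other two factors from assumption \<open>b\<close>.\<close>
  define K where "K = 1024 * e\<^sup>2"
  define Q where "Q = real r powr (- (1 + 1 / real t)) * (\<epsilon>\<^sup>2 / \<alpha>) powr (2 / real t) * real L powr (1 - 2 / real t)"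
  have e1: "e \<ge> 1" unfolding e_def by simp
  have t0: "t > 0" and Lpos: "real L > 0" using assms by auto
  have K1: "1 \<le> K" unfolding K_def using one_le_power[OF e1, of 2] by linarith
  have powt: "(z powr s) ^ t = z powr (s * real t)" if "z > 0" for z s :: real
    using that by (metis powr_gt_zero powr_powr powr_realpow)
  have Qt: "Q ^ t \<le> 4 * \<epsilon>\<^sup>2 / \<alpha>\<^sup>2 * (real L ^ t / real L ^ 2)"
  proof -
    \<comment> \<open>The estimate \<open>b\<close> is uniform in r; the power of r in the claim has
      a negative exponent and is at most 1.\<close>
    have 1: "(real r powr (- (1 + 1 / real t))) ^ t \<le> 1"
    proof (rule power_le_one)
      have "0 \<le> 1 + 1 / real t" by (intro add_nonneg_nonneg) auto
      then have "- (1 + 1 / real t) \<le> 0" by linarith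
      then have "real r powr (- (1 + 1 / real t)) \<le> real r powr 0"
        using assms(6) by (intro powr_mono) auto
      then show "real r powr (- (1 + 1 / real t)) \<le> 1" using assms(6) by simp
    qed simp
    have 2: "((\<epsilon>\<^sup>2 / \<alpha>) powr (2 / real t)) ^ t = (\<epsilon>\<^sup>2 / \<alpha>)\<^sup>2"
    proof -
      have pos: "\<epsilon>\<^sup>2 / \<alpha> > 0" using assms by simp
      have "2 / real t * real t = 2" using t0 by simp
      then show ?thesis using pos by (simp only: powt[OF pos]) simp
    qed
    have 3: "(real L powr (1 - 2 / real t)) ^ t = real L ^ t / real L ^ 2"
    proof -
      have "(1 - 2 / real t) * real t = real t - 2" using t0 by (simp add: left_diff_distrib)
      then show ?thesis using Lpos by (simp only: powt[OF Lpos]) (simp add: powr_diff powr_realpow)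
    qed
    \<comment> \<open>The claim involves \<epsilon>^4 where \<open>b\<close> controls \<epsilon>^2;
      the bound \<epsilon> \<le> 2 trades two powers for a factor 4.\<close>
    have 4: "(\<epsilon>\<^sup>2 / \<alpha>)\<^sup>2 \<le> 4 * \<epsilon>\<^sup>2 / \<alpha>\<^sup>2"
    proof -
      have "\<epsilon>\<^sup>2 \<le> 2\<^sup>2" using assms by (intro power_mono) auto
      then have "\<epsilon>\<^sup>2 * \<epsilon>\<^sup>2 \<le> 4 * \<epsilon>\<^sup>2" by (intro mult_right_mono) auto
      then show ?thesis using assms(1) by (simp add: power_divide divide_right_mono power2_eq_square[of "\<epsilon>\<^sup>2"])
    qed
    have "Q ^ t = (real r powr (- (1 + 1 / real t))) ^ t * ((\<epsilon>\<^sup>2 / \<alpha>)\<^sup>2 * (real L ^ t / real L ^ 2))"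
      unfolding Q_def power_mult_distrib 2 3 by simp
    also have "\<dots> \<le> 1 * (4 * \<epsilon>\<^sup>2 / \<alpha>\<^sup>2 * (real L ^ t / real L ^ 2))"
      using 1 4 by (intro mult_mono) auto
    finally show ?thesis by simp
  qed
  also have "\<dots> \<le> 4 * (16 * ((4 * e * \<alpha>)\<^sup>2 * real L ^ 2 * (8 * e * real m / real L) ^ t)) / \<alpha>\<^sup>2 * (real L ^ t / real L ^ 2)"
    using b unfolding e_def by (intro mult_right_mono divide_right_mono mult_left_mono) auto
  also have "\<dots> = K * (8 * e * real m) ^ t"
    using Lpos assms(1) by (simp add: K_def power_divide power_mult_distrib)
  \<comment> \<open>Enlarging K to its t-th power makes the final constant independent of t.\<close>
  also have "\<dots> \<le> K ^ t * (8 * e * real m) ^ t"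
  proof (intro mult_right_mono)
    show "K \<le> K ^ t" using power_increasing[of 1 t K] K1 t0 by simp
  qed (use e1 in auto)
  also have "\<dots> = (K * (8 * e * real m)) ^ t" by (simp add: power_mult_distrib)
  finally have "Q \<le> K * (8 * e * real m)"
    using power_le_imp_le_base[of Q "t - 1"] t0 K1 e1 by simp
  then have "Q / (8 * e * K) \<le> real m"
    using K1 e1 by (simp add: field_simps)
  then show ?thesis unfolding Q_def e_def K_def by simp
qed

section \<open>From protocols to matrix functions\<close>

abbreviation mat_fun :: "complex mat \<Rightarrow> nat \<Rightarrow> nat \<Rightarrow> complex" where
  "mat_fun A \<equiv> (\<lambda>i j. A $$ (i, j))"

lemma psd_mat_fun:
  assumes "psd_mat d A" shows "psd d (mat_fun A)"
  unfolding psd_def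
proof
  have A: "A \<in> carrier_mat d d" "mat_adjoint A = A" using assms by (auto simp: psd_mat_def)
  have "A $$ (j, i) = cnj (A $$ (i, j))" if "i < d" "j < d" for i j
  proof -
    have "A $$ (j, i) = mat_adjoint A $$ (j, i)" using A(2) by simp
    also have "\<dots> = cnj (A $$ (i, j))" using A(1) that by (simp add: mat_adjoint_def mat_of_rows_def)
    finally show ?thesis .
  qed
  then show "herm d (mat_fun A)" unfolding herm_def by blast
  show "\<forall>v. 0 \<le> Re (bform d (mat_fun A) v v)"
  proof
    fix v :: "nat \<Rightarrow> complex"
    have "(A *\<^sub>v vec d v) \<bullet>c vec d v = bform d (mat_fun A) v v"
      using A(1) by (simp add: scalar_prod_def bform_mapp mapp_def lessThan_atLeast0 mult.commute)
    moreover have "0 \<le> Re ((A *\<^sub>v vec d v) \<bullet>c vec d v)" using assms by (simp add: psd_mat_def)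
    ultimately show "0 \<le> Re (bform d (mat_fun A) v v)" by simp
  qed
qed

lemma born_prob_eq_trace_prod:
  assumes "E \<in> carrier_mat d d" "\<rho> \<in> carrier_mat d d"
  shows "born_prob E \<rho> = trace_prod d (mat_fun E) (mat_fun \<rho>)"
  using assms by (simp add: born_prob_def mat_trace_def trace_prod_def mtr_def mmul_def scalar_prod_def lessThan_atLeast0)

lemma density_mat_fun:
  assumes "density_mat d \<rho>"
  shows "psd d (mat_fun \<rho>)" "mtr d (mat_fun \<rho>) = 1" "\<rho> \<in> carrier_mat d d"
proof -
  show "psd d (mat_fun \<rho>)" using assms by (simp add: density_mat_def psd_mat_fun)
  show \<rho>: "\<rho> \<in> carrier_mat d d" using assms by (simp add: density_mat_def psd_mat_def)
  show "mtr d (mat_fun \<rho>) = 1" using assms \<rho> by (auto simp: density_mat_def mat_trace_def mtr_def)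
qed

text \<open>Positivity of \<open>F False\<close> = I - \<open>F True\<close> yields
  \<open>F True\<close> \<le> I, hence the norm bound. Completeness and unit trace express the NO
  outcome through the YES operator.\<close>

lemma binary_povm_fun:
  assumes "binary_povm d F"
  shows "F b \<in> carrier_mat d d" "herm d (mat_fun (F True))" "opbound d 1 (mat_fun (F True))"
    "density_mat d \<rho> \<Longrightarrow> born_prob (F False) \<rho> = 1 - born_prob (F True) \<rho>"
proof -
  have psdF: "psd_mat d (F True)" "psd_mat d (F False)" and eq: "F True + F False = 1\<^sub>m d"
    using assms by (auto simp: binary_povm_def)
  show carr: "F b \<in> carrier_mat d d" for b using psdF by (cases b) (auto simp: psd_mat_def)
  \<comment> \<open>\<open>mprod d []\<close> serves as the identity matrix.\<close>
  have entry: "mat_fun (F False) i j = mprod d [] i j - mat_fun (F True) i j" if "i < d" "j < d" for i j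
  proof -
    have "(F True + F False) $$ (i, j) = F True $$ (i, j) + F False $$ (i, j)"
      using carr[of True] carr[of False] that by (intro index_add_mat) auto
    then show ?thesis unfolding eq using that by (simp add: algebra_simps)
  qed
  show "herm d (mat_fun (F True))" using psd_mat_fun[OF psdF(1)] by (simp add: psd_def)
  have "Re (bform d (mat_fun (F True)) v v) \<le> (vnorm d v)\<^sup>2" for v
  proof -
    have "bform d (mat_fun (F False)) v v = (\<Sum>i<d. \<Sum>j<d. cnj (v i) * mprod d [] i j * v j - cnj (v i) * mat_fun (F True) i j * v j)"
      unfolding bform_def by (intro sum.cong refl) (simp add: entry algebra_simps del: mprod.simps)
    also have "\<dots> = bform d (mprod d []) v v - bform d (mat_fun (F True)) v v"
      by (simp only: sum_subtractf bform_def)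
    also have "bform d (mprod d []) v v = of_real ((vnorm d v)\<^sup>2)"
    proof -
      have "bform d (mprod d []) v v = (\<Sum>i<d. \<Sum>j<d. if j = i then cnj (v i) * v j else 0)"
        unfolding bform_def by (intro sum.cong refl) auto
      also have "\<dots> = (\<Sum>i<d. of_real ((cmod (v i))\<^sup>2))"
      proof (intro sum.cong refl)
        fix i assume "i \<in> {..<d}"
        then have "(\<Sum>j<d. if j = i then cnj (v i) * v j else 0) = cnj (v i) * v i" by (simp add: sum.delta)
        then show "(\<Sum>j<d. if j = i then cnj (v i) * v j else 0) = of_real ((cmod (v i))\<^sup>2)"
          by (metis complex_norm_square mult.commute)
      qed
      finally show ?thesis by (simp add: vnorm_sq)
    qed
    finally have "Re (bform d (mat_fun (F False)) v v) = (vnorm d v)\<^sup>2 - Re (bform d (mat_fun (F True)) v v)" by simp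
    moreover have "0 \<le> Re (bform d (mat_fun (F False)) v v)" using psd_mat_fun[OF psdF(2)] by (simp add: psd_def)
    ultimately show ?thesis by simp
  qed
  then show "opbound d 1 (mat_fun (F True))" by (intro psd_opbound psd_mat_fun[OF psdF(1)])
  assume \<rho>: "density_mat d \<rho>"
  have "trace_prod d (mat_fun (F False)) (mat_fun \<rho>) = trace_prod d (\<lambda>i j. mprod d [] i j - mat_fun (F True) i j) (mat_fun \<rho>)"
    unfolding trace_prod_def mtr_def mmul_def by (simp add: entry del: mprod.simps)
  also have "\<dots> = trace_prod d (mprod d []) (mat_fun \<rho>) - trace_prod d (mat_fun (F True)) (mat_fun \<rho>)"
    by (rule trace_prod_diff)
  also have "trace_prod d (mprod d []) (mat_fun \<rho>) = 1"
  proof -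
    have "mmul d (mprod d []) (mat_fun \<rho>) i i = \<rho> $$ (i, i)" if "i < d" for i
    proof -
      have "mmul d (mprod d []) (mat_fun \<rho>) i i = (\<Sum>k<d. if k = i then \<rho> $$ (k, i) else 0)"
        unfolding mmul_def by (intro sum.cong refl) auto
      then show ?thesis using that by (simp add: sum.delta)
    qed
    then have "mtr d (mmul d (mprod d []) (mat_fun \<rho>)) = mtr d (mat_fun \<rho>)" by (intro mtr_cong)
    then show ?thesis unfolding trace_prod_def using density_mat_fun(2)[OF \<rho>] by simp
  qed
  finally show "born_prob (F False) \<rho> = 1 - born_prob (F True) \<rho>"
    by (simp only: born_prob_eq_trace_prod[OF carr density_mat_fun(3)[OF \<rho>]])
qed

section \<open>Inputs and expectations as uniform finite sums\<close>

lemma zr_strings_bij: "bij_betw (vec k) (PiE {..<k} (\<lambda>_. {0..<int r})) (zr_strings r k)"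
proof (rule bij_betwI')
  fix x y assume x: "x \<in> PiE {..<k} (\<lambda>_. {0..<int r})" and y: "y \<in> PiE {..<k} (\<lambda>_. {0..<int r})"
  show "(vec k x = vec k y) = (x = y)"
  proof
    assume eq: "vec k x = vec k y"
    have "x i = y i" if "i < k" for i using eq that by (metis index_vec)
    then show "x = y" using x y by (auto intro: PiE_ext)
  qed simp
next
  fix x assume "x \<in> PiE {..<k} (\<lambda>_. {0..<int r})"
  then show "vec k x \<in> zr_strings r k" by (auto simp: zr_strings_def PiE_iff)
next
  fix v assume v: "v \<in> zr_strings r k"
  have "restrict (vec_index v) {..<k} \<in> PiE {..<k} (\<lambda>_. {0..<int r})"
    using v by (auto simp: zr_strings_def)
  moreover have "v = vec k (restrict (vec_index v) {..<k})"
    using v by (intro eq_vecI) (auto simp: zr_strings_def)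
  ultimately show "\<exists>x\<in>PiE {..<k} (\<lambda>_. {0..<int r}). v = vec k x" by blast
qed

lemma finite_zr_strings: "finite (zr_strings r k)"
  using bij_betw_finite[OF zr_strings_bij] finite_PiE_const[of "{..<k}" "{0..<int r}"] by auto

lemma card_zr_strings: "card (zr_strings r k) = card (PiE {..<k} (\<lambda>_. {0..<int r}))"
  using bij_betw_same_card[OF zr_strings_bij] by metis

lemma sum_zr_strings: "(\<Sum>v\<in>zr_strings r k. f v) = (\<Sum>x\<in>PiE {..<k} (\<lambda>_. {0..<int r}). f (vec k x))"
  using sum.reindex_bij_betw[OF zr_strings_bij] by metis

lemma zr_strings_nonempty: "r > 0 \<Longrightarrow> zr_strings r k \<noteq> {}"
  using card_zr_strings[of r k] card_PiE_const_pos[of "{..<k}" "{0..<int r}"] by fastforce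

lemma hypermatchings_eq:
  assumes "real N = \<alpha> * real n / real t"
  shows "hypermatchings \<alpha> t n = hmatch n t N"
  unfolding hypermatchings_def hmatch_def assms[symmetric] by auto

text \<open>Consecutive blocks of length t form a matching. Without nonemptiness,
  \<open>pmf_of_set\<close> and the averages over matchings would carry no meaning.\<close>

lemma hmatch_nonempty:
  assumes "t * N \<le> n"
  shows "hmatch n t N \<noteq> {}"
proof -
  define M where "M = map (\<lambda>i. {t * i..<t * i + t}) [0..<N]"
  have "{t * i..<t * i + t} \<subseteq> {..<n}" if "i < N" for i
  proof -
    have "t * i + t = t * Suc i" by simp
    also have "\<dots> \<le> t * N" using that by (intro mult_le_mono2) simp
    finally show ?thesis using assms by auto
  qed
  moreover have "{t * i..<t * i + t} \<inter> {t * j..<t * j + t} = {}" if "i \<noteq> j" for i j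
  proof -
    have "t * a + t \<le> t * b" if "a < b" for a b
      using mult_le_mono2[of "Suc a" b t] that by simp
    then show ?thesis using that by (cases i j rule: linorder_cases) fastforce+
  qed
  ultimately have "M \<in> hmatch n t N" by (auto simp: hmatch_def M_def)
  then show ?thesis by blast
qed

lemma hh_label_vec:
  assumes "M \<in> hmatch n t N"
  shows "hh_label r n M (vec n x) = vec N (edge_labels r N M x)"
proof (rule eq_vecI)
  have len: "length M = N" using assms by (simp add: hmatch_def)
  show "dim_vec (hh_label r n M (vec n x)) = dim_vec (vec N (edge_labels r N M x))"
    by (simp add: hh_label_def incidence_mat_def len)
  fix i assume "i < dim_vec (vec N (edge_labels r N M x))"
  then have i: "i < N" by simp
  have "(\<Sum>j = 0..<n. (if j \<in> M ! i then 1 else 0) * x j) = (\<Sum>j\<in>{..<n}. if j \<in> M ! i then x j else 0)"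
    unfolding lessThan_atLeast0 by (intro sum.cong refl) auto
  also have "\<dots> = (\<Sum>j\<in>{..<n} \<inter> M ! i. x j)" by (simp add: sum.inter_restrict)
  also have "{..<n} \<inter> M ! i = M ! i" using hmatch_edge(1)[OF assms i] by auto
  finally show "vec_index (hh_label r n M (vec n x)) i = vec_index (vec N (edge_labels r N M x)) i"
    using i len by (simp add: hh_label_def incidence_mat_def scalar_prod_def edge_labels_def)
qed

lemma expectation_hh_yes:
  fixes f :: "int vec \<times> nat set list \<times> int vec \<Rightarrow> real"
  assumes "finite (hypermatchings \<alpha> t n)" "hypermatchings \<alpha> t n \<noteq> {}" "r > 0"
  shows "measure_pmf.expectation (hh_yes r \<alpha> t n) f =
    (\<Sum>x\<in>zr_strings r n. (\<Sum>M\<in>hypermatchings \<alpha> t n. f (x, M, hh_label r n M x))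
       / card (hypermatchings \<alpha> t n)) / card (zr_strings r n)"
  unfolding hh_yes_def
  by (simp add: pmf_expectation_bind_pmf_of_set finite_zr_strings zr_strings_nonempty assms set_pmf_of_set
      sum_distrib_left divide_inverse_commute)

lemma expectation_hh_no:
  fixes f :: "int vec \<times> nat set list \<times> int vec \<Rightarrow> real"
  assumes "finite (hypermatchings \<alpha> t n)" "hypermatchings \<alpha> t n \<noteq> {}" "r > 0"
  shows "measure_pmf.expectation (hh_no r \<alpha> t n) f =
    (\<Sum>x\<in>zr_strings r n. (\<Sum>M\<in>hypermatchings \<alpha> t n.
       (\<Sum>w\<in>zr_strings r (length M). f (x, M, w)) / card (zr_strings r (length M)))
       / card (hypermatchings \<alpha> t n)) / card (zr_strings r n)"
  unfolding hh_no_def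
  by (simp add: pmf_expectation_bind_pmf_of_set finite_zr_strings zr_strings_nonempty assms set_pmf_of_set
      sum_distrib_left divide_inverse_commute)

lemma protocol_message:
  assumes "one_way_quantum_protocol r \<alpha> t n m P" "x \<in> PiE {..<n} (\<lambda>_. {0..<int r})"
  shows "density_mat (2 ^ m) (message P (vec n x))"
  using assms bij_betwE[OF zr_strings_bij] unfolding one_way_quantum_protocol_def by blast

lemma protocol_measurement:
  assumes P: "one_way_quantum_protocol r \<alpha> t n m P" and N: "real N = \<alpha> * real n / real t"
    and M: "M \<in> hmatch n t N" and w: "w \<in> PiE {..<N} (\<lambda>_. {0..<int r})"
  shows "binary_povm (2 ^ m) (measurement P M (vec N w))"
proof -
  have "length M = N" using M by (simp add: hmatch_def)
  moreover have "vec N w \<in> zr_strings r N" using bij_betwE[OF zr_strings_bij] w by blast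
  ultimately show ?thesis
    using P M unfolding one_way_quantum_protocol_def hypermatchings_eq[OF N] by blast
qed

text \<open>The probability of a NO answer is 1 minus that of YES, so success is 1/2 plus half the
  difference between the YES probabilities under the two distributions.\<close>

lemma success_prob_eq_label_gap:
  assumes r: "r > 0" and N: "real N = \<alpha> * real n / real t" and ne: "hmatch n t N \<noteq> {}"
    and P: "one_way_quantum_protocol r \<alpha> t n m P"
  shows "success_prob r \<alpha> t n P = 1 / 2 +
    label_gap (2 ^ m) r n t N (\<lambda>M w. mat_fun (measurement P M (vec N w) True)) (\<lambda>x. mat_fun (message P (vec n x))) / 2"
proof -
  let ?A = "{0..<int r}"
  let ?X = "PiE {..<n} (\<lambda>_. ?A)" and ?W = "PiE {..<N} (\<lambda>_. ?A)" and ?H = "hmatch n t N"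
  define a where "a = (\<lambda>x M w. trace_prod (2 ^ m) (mat_fun (measurement P M (vec N w) True)) (mat_fun (message P (vec n x))))"
  have H: "hypermatchings \<alpha> t n = ?H" by (rule hypermatchings_eq[OF N])
  have fin: "finite (hypermatchings \<alpha> t n)" "hypermatchings \<alpha> t n \<noteq> {}"
    unfolding H using finite_hmatch ne by auto
  have X: "real (card ?X) > 0" and W: "real (card ?W) > 0"
    using r by (simp_all add: card_PiE_const_pos)
  have Hpos: "real (card ?H) > 0" using ne finite_hmatch by (simp add: card_gt_0_iff)
  note dens = protocol_message[OF P] and povm = protocol_measurement[OF P N]
  have T: "born_prob (measurement P M (vec N w) True) (message P (vec n x)) = a x M w"
    if "x \<in> ?X" "M \<in> ?H" "w \<in> ?W" for x M w
    unfolding a_def by (rule born_prob_eq_trace_prod[OF binary_povm_fun(1)[OF povm[OF that(2,3)]] density_mat_fun(3)[OF dens[OF that(1)]]])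
  have F: "born_prob (measurement P M (vec N w) False) (message P (vec n x)) = 1 - a x M w"
    if "x \<in> ?X" "M \<in> ?H" "w \<in> ?W" for x M w
    using binary_povm_fun(4)[OF povm[OF that(2,3)] dens[OF that(1)]] T[OF that] by simp
  have "measure_pmf.expectation (hh_yes r \<alpha> t n) (\<lambda>(x, M, w). born_prob (measurement P M w True) (message P x)) =
    (\<Sum>x\<in>?X. (\<Sum>M\<in>?H. born_prob (measurement P M (hh_label r n M (vec n x)) True) (message P (vec n x))) / card ?H) / card ?X"
    by (subst expectation_hh_yes[OF fin r]) (simp add: sum_zr_strings card_zr_strings H)
  also have "\<dots> = (\<Sum>x\<in>?X. (\<Sum>M\<in>?H. a x M (edge_labels r N M x)) / card ?H) / card ?X"
    by (intro arg_cong2[where f = "(/)"] sum.cong refl) (simp add: hh_label_vec T edge_labels_PiE r)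
  finally have yes: "measure_pmf.expectation (hh_yes r \<alpha> t n) (\<lambda>(x, M, w). born_prob (measurement P M w True) (message P x)) =
    (\<Sum>x\<in>?X. (\<Sum>M\<in>?H. a x M (edge_labels r N M x)) / card ?H) / card ?X" .
  have "measure_pmf.expectation (hh_no r \<alpha> t n) (\<lambda>(x, M, w). born_prob (measurement P M w False) (message P x)) =
    (\<Sum>x\<in>?X. (\<Sum>M\<in>?H. (\<Sum>w\<in>PiE {..<length M} (\<lambda>_. ?A). born_prob (measurement P M (vec (length M) w) False) (message P (vec n x)))
       / card (PiE {..<length M} (\<lambda>_. ?A))) / card ?H) / card ?X"
    by (subst expectation_hh_no[OF fin r]) (simp add: sum_zr_strings card_zr_strings H)
  also have "\<dots> = (\<Sum>x\<in>?X. (\<Sum>M\<in>?H. 1 - (\<Sum>w\<in>?W. a x M w) / card ?W) / card ?H) / card ?X"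
  proof (intro arg_cong2[where f = "(/)"] sum.cong refl)
    fix x M assume x: "x \<in> ?X" and M: "M \<in> ?H"
    have len: "length M = N" using M by (simp add: hmatch_def)
    have "(\<Sum>w\<in>?W. born_prob (measurement P M (vec N w) False) (message P (vec n x))) = (\<Sum>w\<in>?W. 1 - a x M w)"
      by (intro sum.cong refl F x M)
    then show "(\<Sum>w\<in>PiE {..<length M} (\<lambda>_. ?A). born_prob (measurement P M (vec (length M) w) False) (message P (vec n x)))
       / card (PiE {..<length M} (\<lambda>_. ?A)) = 1 - (\<Sum>w\<in>?W. a x M w) / card ?W"
      unfolding len using W by (simp add: sum_subtractf diff_divide_distrib)
  qed
  also have "\<dots> = 1 - (\<Sum>x\<in>?X. (\<Sum>M\<in>?H. (\<Sum>w\<in>?W. a x M w) / card ?W) / card ?H) / card ?X"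
    using X Hpos by (simp add: sum_subtractf diff_divide_distrib)
  finally have no: "measure_pmf.expectation (hh_no r \<alpha> t n) (\<lambda>(x, M, w). born_prob (measurement P M w False) (message P x)) =
    1 - (\<Sum>x\<in>?X. (\<Sum>M\<in>?H. (\<Sum>w\<in>?W. a x M w) / card ?W) / card ?H) / card ?X" .
  have "label_gap (2 ^ m) r n t N (\<lambda>M w. mat_fun (measurement P M (vec N w) True)) (\<lambda>x. mat_fun (message P (vec n x))) =
    (\<Sum>x\<in>?X. (\<Sum>M\<in>?H. a x M (edge_labels r N M x)) / card ?H) / card ?X -
    (\<Sum>x\<in>?X. (\<Sum>M\<in>?H. (\<Sum>w\<in>?W. a x M w) / card ?W) / card ?H) / card ?X"
    unfolding label_gap_def a_def[symmetric] by (simp only: sum_subtractf diff_divide_distrib a_def)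
  then show ?thesis unfolding success_prob_def yes no by simp
qed

theorem theorem4p4:
  shows "\<exists>c::real. c > 0 \<and>
    (\<forall>(r::nat) (t::nat) (n::nat) (\<alpha>::real) (\<epsilon>::real) (m::nat) (P::hh_protocol).
       r \<ge> 2 \<longrightarrow> t \<ge> 3 \<longrightarrow> t dvd n \<longrightarrow> 0 < \<alpha> \<longrightarrow> \<alpha> \<le> 1 \<longrightarrow> \<alpha> * real n / real t \<in> \<int> \<longrightarrow>
       \<alpha> \<le> min (1 / 2) ((real r - 1) powr (- 1 / 2)) \<longrightarrow>
       \<epsilon> > 0 \<longrightarrow>
       one_way_quantum_protocol r \<alpha> t n m P \<longrightarrow>
       achieves_advantage r \<alpha> t n P \<epsilon> \<longrightarrow>
       real m \<ge> c * (real r powr (- (1 + 1 / real t)) * (\<epsilon>\<^sup>2 / \<alpha>) powr (2 / real t)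
                      * (real n / real t) powr (1 - 2 / real t)))"
proof (intro exI[of _ "1 / (8 * exp 1 * (1024 * (exp 1)\<^sup>2))"] conjI allI impI)
  show "0 < 1 / (8 * exp 1 * (1024 * (exp 1)\<^sup>2) :: real)" by simp
next
  fix r t n m :: nat and \<alpha> \<epsilon> :: real and P :: hh_protocol
  assume r: "2 \<le> r" and t: "3 \<le> t" and tn: "t dvd n" and \<alpha>: "0 < \<alpha>" and int: "\<alpha> * real n / real t \<in> \<int>"
    and min: "\<alpha> \<le> min (1 / 2) ((real r - 1) powr (- 1 / 2))" and \<epsilon>: "0 < \<epsilon>"
    and P: "one_way_quantum_protocol r \<alpha> t n m P" and adv: "achieves_advantage r \<alpha> t n P \<epsilon>"
  have r0: "r > 0" and \<alpha>2: "\<alpha> \<le> 1 / 2" using r min by auto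
  obtain L where n: "n = t * L" using tn by auto
  have nt: "real n / real t = real L" using n t by simp
  show "1 / (8 * exp 1 * (1024 * (exp 1)\<^sup>2)) * (real r powr (- (1 + 1 / real t)) * (\<epsilon>\<^sup>2 / \<alpha>) powr (2 / real t)
      * (real n / real t) powr (1 - 2 / real t)) \<le> real m"
  proof (cases "L = 0")
    case True
    \<comment> \<open>\<open>0 powr _\<close> is 0, so for n = 0 the claimed lower bound is
      0.\<close>
    then show ?thesis unfolding nt by simp
  next
    case False
    then have Lpos: "L > 0" by simp
    have "0 \<le> \<alpha> * real n / real t" using \<alpha> by simp
    then obtain N :: nat where N: "real N = \<alpha> * real n / real t"
      using int by (metis Ints_cases nonneg_int_cases of_int_0_le_iff of_int_of_nat_eq)
    have NL: "real N = \<alpha> * real L" unfolding N nt[symmetric] by simp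
    have "real N \<le> real L" using NL \<alpha> \<alpha>2 mult_right_mono[of \<alpha> 1 "real L"] by simp
    then have ne: "hmatch n t N \<noteq> {}" unfolding n by (intro hmatch_nonempty) simp
    define F where "F = (\<lambda>M w. mat_fun (measurement P M (vec N w) True))"
    define R where "R = (\<lambda>x. mat_fun (message P (vec n x)))"
    note dens = protocol_message[OF P] and povm = protocol_measurement[OF P N]
    have gap: "2 * \<epsilon> \<le> label_gap (2 ^ m) r n t N F R"
      using adv unfolding achieves_advantage_def success_prob_eq_label_gap[OF r0 N ne P] F_def R_def by simp
    have F1: "opbound (2 ^ m) 1 (F M w)" and F2: "herm (2 ^ m) (F M w)"
      if "M \<in> hmatch n t N" "w \<in> PiE {..<N} (\<lambda>_. {0..<int r})" for M w
      using binary_povm_fun(3,2)[OF povm[OF that]] unfolding F_def .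
    have R1: "psd (2 ^ m) (R x)" and R2: "mtr (2 ^ m) (R x) = 1"
      if "x \<in> PiE {..<n} (\<lambda>_. {0..<int r})" for x
      using density_mat_fun(1,2)[OF dens[OF that]] unfolding R_def .
    note le = label_gap_square_le[OF r0 refl NL Lpos \<alpha> \<alpha>2 t n ne F1 F2 R1 R2 \<epsilon> gap]
    show ?thesis unfolding nt by (rule qubits_lower_bound[OF \<alpha> \<epsilon> le(1) Lpos t r le(2)])
  qed
qed

end
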